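(* Let $\tau\in\mathbb{C}$ with $\mathrm{Im}(\tau)>0$, $q=e^{i\pi\tau}$ (with $q^{s}=e^{i\pi\tau s}$), and let $z=\tfrac12+\alpha+\beta\tau$ with $(\alpha,\beta)\in\mathbb{R}^2$. Put $SN(z,\tau)=\frac{Kk}{2\pi}\,\mathrm{sn}(2Kz)$. If $|\beta|<\tfrac12$, then $$SN(z,\tau)=\sum_{n=0}^{+\infty}\frac{q^{n+\frac12}\sin((2n+1)\pi z)}{1-q^{2n+1}}=\frac{i}{2}\sum_{n=0}^{+\infty}\frac{\sin((2n+1)\pi z)}{\sin((n+\frac12)\pi\tau)},$$ and if $|\alpha|<\tfrac12$, then $$SN(z,\tau)=\frac{i}{4\tau}+\frac{i}{2\tau}\sum_{n=1}^{+\infty}\frac{(-1)^n\cos\left(n\pi(2z-1)/\tau\right)}{\cos(n\pi/\tau)}.$$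
   Context: The Jacobi functions are taken with parameter $\tau=iK'/K$ and nome $q=e^{i\pi\tau}$. Explicitly, with $q^s=e^{i\pi\tau s}$, let $\theta_1(v)=2\sum_{n\ge0}(-1)^nq^{(n+1/2)^2}\sin((2n+1)v)$, $\theta_2(v)=2\sum_{n\ge0}q^{(n+1/2)^2}\cos((2n+1)v)$, $\theta_3(v)=1+2\sum_{n\ge1}q^{n^2}\cos(2nv)$, $\theta_4(v)=1+2\sum_{n\ge1}(-1)^nq^{n^2}\cos(2nv)$, and $\theta_j=\theta_j(0)$. Then $k=\theta_2^2/\theta_3^2$, $k'=\theta_4^2/\theta_3^2$, $K=\frac{\pi}{2}\theta_3^2$, and $\mathrm{sn}(2Kz)=\frac{\theta_3}{\theta_2}\frac{\theta_1(\pi z)}{\theta_4(\pi z)}$. When $\tau$ is purely imaginary these are the classical Jacobi modulus, complete elliptic integral and function $\mathrm{sn}$. *)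

theory Defs
  imports "HOL-Analysis.Analysis"
begin

text \<open>
  All functions are parametrised by \<open>\<tau>\<close> in the upper half-plane. Powers of the nome
  \<open>q = exp (\<i> \<pi> \<tau>)\<close> are taken with the branch fixed by \<open>\<tau>\<close>, not with the principal
  branch of the logarithm of \<open>q\<close>, so \<open>powr\<close> cannot be used here.
\<close>

definition qpow :: "complex \<Rightarrow> real \<Rightarrow> complex" where
  "qpow \<tau> s = exp (\<i> * of_real pi * \<tau> * of_real s)"

definition theta1 :: "complex \<Rightarrow> complex \<Rightarrow> complex" where
  "theta1 \<tau> v =
     2 * (\<Sum>n. (-1) ^ n * qpow \<tau> ((real n + 1/2)\<^sup>2) * sin ((2 * of_nat n + 1) * v))"

definition theta2 :: "complex \<Rightarrow> complex \<Rightarrow> complex" where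
  "theta2 \<tau> v =
     2 * (\<Sum>n. qpow \<tau> ((real n + 1/2)\<^sup>2) * cos ((2 * of_nat n + 1) * v))"

definition theta3 :: "complex \<Rightarrow> complex \<Rightarrow> complex" where
  "theta3 \<tau> v =
     1 + 2 * (\<Sum>n. qpow \<tau> ((real (Suc n))\<^sup>2) * cos (2 * of_nat (Suc n) * v))"

definition theta4 :: "complex \<Rightarrow> complex \<Rightarrow> complex" where
  "theta4 \<tau> v =
     1 + 2 * (\<Sum>n. (-1) ^ Suc n * qpow \<tau> ((real (Suc n))\<^sup>2) * cos (2 * of_nat (Suc n) * v))"

definition jacobi_k :: "complex \<Rightarrow> complex" where
  "jacobi_k \<tau> = (theta2 \<tau> 0)\<^sup>2 / (theta3 \<tau> 0)\<^sup>2"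

definition jacobi_K :: "complex \<Rightarrow> complex" where
  "jacobi_K \<tau> = of_real pi / 2 * (theta3 \<tau> 0)\<^sup>2"

text \<open>The defining formula for \<open>sn (2 K z)\<close>, read at \<open>z = u / (2 K)\<close>.\<close>

definition jacobi_sn :: "complex \<Rightarrow> complex \<Rightarrow> complex" where
  "jacobi_sn \<tau> u =
     (let z = u / (2 * jacobi_K \<tau>)
      in theta3 \<tau> 0 / theta2 \<tau> 0 * (theta1 \<tau> (of_real pi * z) / theta4 \<tau> (of_real pi * z)))"

definition SN :: "complex \<Rightarrow> complex \<Rightarrow> complex" where
  "SN z \<tau> = jacobi_K \<tau> * jacobi_k \<tau> / (2 * of_real pi) * jacobi_sn \<tau> (2 * jacobi_K \<tau> * z)"

end

theory Submission
  imports Defs "HOL-Complex_Analysis.Complex_Analysis"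
begin

text \<open>
  Both series are bilateral sums \<open>\<Sum>n\<in>\<int>. X ^ n / (1 - P ^ n * W)\<close>: the sine series with \<open>P = q\<^sup>2\<close>,
  \<open>W = q\<close>, the cosine series with \<open>P = p\<^sup>2\<close>, \<open>W = - 1\<close>, where \<open>p = exp (- \<i> \<pi> / \<tau>)\<close>. Such a sum continues
  to a wider annulus with one simple pole and is multiplied by \<open>1 / W\<close> under \<open>X \<mapsto> P * X\<close>. Hence both
  series, like the quotient of theta functions, change sign under \<open>z \<mapsto> z + 1\<close>, are invariant under
  \<open>z \<mapsto> z + \<tau>\<close>, and have a single simple pole in a cell, with residue \<open>- 1 / (4 \<pi>)\<close> at \<open>1 - \<tau> / 2\<close>. The
  difference of two functions of this kind is holomorphic and attains its maximum modulus, so it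
  is constant, and it vanishes because it changes sign. For the theta quotient, the zeros and the
  residue come from the Jacobi triple product, obtained as the limit of its finite form.
\<close>

subsection \<open>Uniqueness of quasi-elliptic functions with one pole\<close>

text \<open>Neither series defines a function on the whole plane: each converges on a strip, and the
  two strips run in different lattice directions. Uniqueness is therefore formulated on a doubled
  cell, where the continuation \<open>kronecker\<close> is available, and each identity is then
  carried along its strip by the translation that preserves the strip. The weights are dictated by
  the multiplier 1 / W. For the sine series the prefactor \<open>nome w\<close> gains a factor q
  under w + \<tau>, so W = q makes the product periodic. For the cosine series, in the variable w /
  \<tau>, the shift w - 1 becomes a shift by -1 / \<tau>, and W = -1 supplies the sign. The origin
  is moved to the pole 1 - \<tau> / 2 because in w = z - 1 + \<tau> / 2 the condition |\<beta>| <
  1/2 reads 0 < \<open>lat_im\<close> < 1 and |\<alpha>| < 1/2 reads -1 < \<open>lat_re\<close> < 0,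
  which are the strips of the two bilateral sums. The isolated term i / (4 \<tau>) is the index n =
  0 of the second sum, where 1 / (1 - W) = 1 / 2.\<close>

definition lat_re :: "complex \<Rightarrow> complex \<Rightarrow> real" where
  "lat_re \<tau> w = Re w - Im w / Im \<tau> * Re \<tau>"

definition lat_im :: "complex \<Rightarrow> complex \<Rightarrow> real" where
  "lat_im \<tau> w = Im w / Im \<tau>"

text \<open>
  The period parallelogram of twice the side length, centred at the pole: it contains a full
  cell together with its translates, so the maximum of a quasi-periodic function is interior.
\<close>

definition cell :: "complex \<Rightarrow> complex set" where
  "cell \<tau> = {w. \<bar>lat_re \<tau> w\<bar> < 1 \<and> \<bar>lat_im \<tau> w\<bar> < 1}"

lemma lat_coords [simp]:
  assumes "Im \<tau> > 0"
  shows "lat_re \<tau> (of_real a + of_real b * \<tau>) = a"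
    and "lat_im \<tau> (of_real a + of_real b * \<tau>) = b"
  using assms by (auto simp: lat_re_def lat_im_def)

lemma lat_decomp:
  assumes "Im \<tau> > 0"
  shows "w = of_real (lat_re \<tau> w) + of_real (lat_im \<tau> w) * \<tau>"
  using assms by (simp add: lat_re_def lat_im_def complex_eq_iff)

lemma continuous_lat [continuous_intros]:
  "continuous_on A (lat_re \<tau>)" "continuous_on A (lat_im \<tau>)"
  unfolding lat_re_def lat_im_def divide_inverse by (intro continuous_intros)+

lemma open_cell: "open (cell \<tau>)"
  unfolding cell_def by (intro open_Collect_conj open_Collect_less continuous_intros)

lemma convex_cell: "convex (cell \<tau>)"
proof -
  have "linear (lat_re \<tau>)" "linear (lat_im \<tau>)"
    unfolding lat_re_def lat_im_def
    by (auto intro!: linearI simp: algebra_simps add_divide_distrib)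
  moreover have "cell \<tau> = lat_re \<tau> -` ball 0 1 \<inter> lat_im \<tau> -` ball 0 1"
    by (auto simp: cell_def dist_real_def)
  ultimately show ?thesis
    by (simp add: convex_Int convex_linear_vimage)
qed

lemma elliptic_unique:
  assumes \<tau>: "Im \<tau> > 0"
    and hol: "D holomorphic_on cell \<tau> - {0}"
    and lim: "((\<lambda>w. w * D w) \<longlongrightarrow> 0) (at 0)"
    and anti: "\<And>a b. 0 < a \<Longrightarrow> a < 1 \<Longrightarrow> \<bar>b\<bar> < 1 \<Longrightarrow>
      D (of_real (a - 1) + of_real b * \<tau>) = - D (of_real a + of_real b * \<tau>)"
    and per: "\<And>a b. \<bar>a\<bar> < 1 \<Longrightarrow> 0 < b \<Longrightarrow> b < 1 \<Longrightarrow>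
      D (of_real a + of_real (b - 1) * \<tau>) = D (of_real a + of_real b * \<tau>)"
    and w: "w \<in> cell \<tau> - {0}"
  shows "D w = 0"
proof -
  have zero_cell: "0 \<in> cell \<tau>"
    by (simp add: cell_def lat_re_def lat_im_def)
  \<comment> \<open>Removability is used twice: w * D w extends by 0, and the derivative of this
    extension at 0 is the limit of D itself, hence the value that extends D.\<close>
  define h where "h = (\<lambda>w. if w = 0 then 0 else w * D w)"
  have holh: "h holomorphic_on cell \<tau>"
    unfolding h_def
    by (rule removable_singularity) (auto intro!: holomorphic_intros hol open_cell lim)
  have "(h has_field_derivative deriv h 0) (at 0)"
    using holh open_cell zero_cell by (metis holomorphic_derivI)
  hence "((\<lambda>w. h w / w) \<longlongrightarrow> deriv h 0) (at 0)"
    by (simp add: DERIV_def) (simp add: h_def)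
  hence "(D \<longlongrightarrow> deriv h 0) (at 0)"
    by (rule Lim_transform_eventually) (auto simp: eventually_at_filter h_def)
  note limD = this
  define E where "E = (\<lambda>w. if w = 0 then deriv h 0 else D w)"
  have holE: "E holomorphic_on cell \<tau>"
    unfolding E_def by (rule removable_singularity[OF hol open_cell limD])
  have ED: "E (of_real a + of_real b * \<tau>) = D (of_real a + of_real b * \<tau>)" if "a \<noteq> 0 \<or> b \<noteq> 0" for a b
  proof -
    have "of_real a + of_real b * \<tau> \<noteq> 0"
      using that \<tau> by (auto simp: complex_eq_iff)
    thus ?thesis by (simp add: E_def)
  qed
  have antiE: "E (of_real (a - 1) + of_real b * \<tau>) = - E (of_real a + of_real b * \<tau>)"
    if "0 < a" "a < 1" "\<bar>b\<bar> < 1" for a b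
    using anti[OF that] that by (subst (1 2) ED) auto
  have perE: "E (of_real a + of_real (b - 1) * \<tau>) = E (of_real a + of_real b * \<tau>)"
    if "\<bar>a\<bar> < 1" "0 < b" "b < 1" for a b
    using per[OF that] that by (subst (1 2) ED) auto
  \<comment> \<open>The closed cell of side 1 about the pole. Translations by 1 and \<tau> bring
    every point of \<open>cell \<tau>\<close> into it without changing the norm of E, so a maximum
    over this compact set is a maximum over the open doubled cell.\<close>
  define C where "C = (\<lambda>(a, b). of_real a + of_real b * \<tau>) ` ({-1/2..1/2} \<times> {-1/2..1/2::real})"
  have "compact C"
    unfolding C_def
    by (intro compact_continuous_image compact_Times compact_Icc)
       (auto simp: case_prod_unfold intro!: continuous_intros)
  have "C \<subseteq> cell \<tau>"
    using \<tau> by (auto simp: C_def cell_def)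
  have "continuous_on C (\<lambda>w. norm (E w))"
    by (intro continuous_on_norm holomorphic_on_imp_continuous_on holomorphic_on_subset[OF holE] \<open>C \<subseteq> _\<close>)
  moreover have "C \<noteq> {}" by (auto simp: C_def)
  ultimately obtain \<xi> where \<xi>: "\<xi> \<in> C" "\<And>w. w \<in> C \<Longrightarrow> norm (E w) \<le> norm (E \<xi>)"
    using continuous_attains_sup[OF \<open>compact C\<close>] by metis
  have le1: "norm (E (of_real a + of_real b * \<tau>)) \<le> norm (E \<xi>)" if "\<bar>a\<bar> \<le> 1/2" "\<bar>b\<bar> \<le> 1/2" for a b
  proof (rule \<xi>(2))
    show "of_real a + of_real b * \<tau> \<in> C"
      unfolding C_def using that by (intro image_eqI[of _ _ "(a, b)"]) auto
  qed
  have le2: "norm (E (of_real a + of_real b * \<tau>)) \<le> norm (E \<xi>)" if "\<bar>a\<bar> < 1" "\<bar>b\<bar> \<le> 1/2" for a b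
  proof -
    consider "\<bar>a\<bar> \<le> 1/2" | "a > 1/2" | "a < -1/2" by linarith
    thus ?thesis
    proof cases
      case 2
      thus ?thesis using le1[of "a - 1" b] antiE[of a b] that by simp
    next
      case 3
      thus ?thesis using le1[of "a + 1" b] antiE[of "a + 1" b] that by simp
    qed (use le1 that in auto)
  qed
  have le3: "norm (E (of_real a + of_real b * \<tau>)) \<le> norm (E \<xi>)" if "\<bar>a\<bar> < 1" "\<bar>b\<bar> < 1" for a b
  proof -
    consider "\<bar>b\<bar> \<le> 1/2" | "b > 1/2" | "b < -1/2" by linarith
    thus ?thesis
    proof cases
      case 2
      thus ?thesis using le2[of a "b - 1"] perE[of a b] that by simp
    next
      case 3
      thus ?thesis using le2[of a "b + 1"] perE[of a "b + 1"] that by simp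
    qed (use le2 that in auto)
  qed
  have le: "norm (E u) \<le> norm (E \<xi>)" if "u \<in> cell \<tau>" for u
    using le3[of "lat_re \<tau> u" "lat_im \<tau> u"] that lat_decomp[OF \<tau>, of u] by (simp add: cell_def)
  have "E constant_on cell \<tau>"
    by (rule maximum_modulus_principle[OF holE open_cell convex_connected[OF convex_cell] open_cell order.refl _ le])
       (use \<xi> \<open>C \<subseteq> _\<close> in auto)
  then obtain c where c: "\<And>u. u \<in> cell \<tau> \<Longrightarrow> E u = c"
    by (auto simp: constant_on_def)
  \<comment> \<open>The points 1/2 and -1/2 both lie in the cell and differ by 1, so the constant
    satisfies c = - c.\<close>
  have "of_real a + of_real 0 * \<tau> \<in> cell \<tau>" if "\<bar>a\<bar> < 1" for a
    using that \<tau> unfolding cell_def mem_Collect_eq lat_coords[OF \<tau>] by simp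
  from c[OF this[of "1/2"]] c[OF this[of "1/2 - 1"]] antiE[of "1/2" 0] have "c = 0"
    by simp
  thus ?thesis
    using c[of w] w by (simp add: E_def)
qed

subsection \<open>The Kronecker function\<close>

definition lambert :: "complex \<Rightarrow> complex \<Rightarrow> complex \<Rightarrow> complex" where
  "lambert P W u = (\<Sum>n. u ^ n / (1 - P ^ n * W))"

text \<open>The coefficients tend to 1. Being bounded, they give every \<open>lambert P W\<close>
  the whole unit disc as a domain of convergence.\<close>

lemma lambert_coeff_bounded:
  fixes P W :: complex
  assumes P: "norm P < 1"
  obtains B where "\<And>n. norm (1 / (1 - P ^ n * W)) \<le> B" 
proof -
  have "(\<lambda>n. 1 / (1 - P ^ n * W)) \<longlonglongrightarrow> 1 / (1 - 0 * W)"
    by (intro tendsto_divide tendsto_diff tendsto_mult tendsto_const LIMSEQ_power_zero P) auto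
  hence "Bseq (\<lambda>n. 1 / (1 - P ^ n * W))"
    using convergentI convergent_imp_Bseq by blast
  thus ?thesis using that by (auto simp: Bseq_def)
qed

lemma summable_lambert:
  fixes P W u :: complex
  assumes P: "norm P < 1" and u: "norm u < 1"
  shows "summable (\<lambda>n. u ^ n / (1 - P ^ n * W))"
proof -
  obtain B where B: "\<And>n. norm (1 / (1 - P ^ n * W)) \<le> B"
    using lambert_coeff_bounded[OF P] by blast
  show ?thesis
  proof (rule summable_comparison_test'[where N = 0])
    show "summable (\<lambda>n. B * norm u ^ n)"
      using u by (intro summable_mult summable_geometric) auto
    show "norm (u ^ n / (1 - P ^ n * W)) \<le> B * norm u ^ n" for n
      using mult_right_mono[OF B, of "norm u ^ n" n]
      by (simp add: norm_divide norm_power)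
  qed
qed

lemma lambert_holomorphic:
  assumes P: "norm P < 1"
  shows "lambert P W holomorphic_on ball 0 1"
proof (rule power_series_holomorphic)
  fix u :: complex assume "u \<in> ball 0 1"
  hence "summable (\<lambda>n. u ^ n / (1 - P ^ n * W))"
    by (intro summable_lambert P) auto
  thus "(\<lambda>n. 1 / (1 - P ^ n * W) * (u - 0) ^ n) sums lambert P W u"
    using summable_sums by (fastforce simp: lambert_def)
qed

text \<open>Termwise 1 / (1 - c) = 1 + c / (1 - c) with c = P ^ n * W. The right-hand side sees u
  only through the geometric sum and P * u, which is what carries the series past the unit
  circle.\<close>

lemma lambert_shift:
  assumes P: "norm P < 1" and u: "norm u < 1" and W: "\<And>n. P ^ n * W \<noteq> 1"
  shows "lambert P W u = 1 / (1 - u) + W * lambert P W (P * u)"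
proof -
  have "norm (P * u) < 1"
    using P u by (metis norm_mult mult_less_cancel_right2 norm_ge_zero mult_strict_mono' mult_1 )
  hence "(\<lambda>n. W * ((P * u) ^ n / (1 - P ^ n * W))) sums (W * lambert P W (P * u))"
    unfolding lambert_def by (intro sums_mult summable_sums summable_lambert P)
  from sums_add[OF geometric_sums[OF u] this]
  have "(\<lambda>n. u ^ n + W * ((P * u) ^ n / (1 - P ^ n * W))) sums (1 / (1 - u) + W * lambert P W (P * u))" .
  also have "(\<lambda>n. u ^ n + W * ((P * u) ^ n / (1 - P ^ n * W))) = (\<lambda>n. u ^ n / (1 - P ^ n * W))"
  proof
    fix n
    have "1 - P ^ n * W \<noteq> 0" using W[of n] by simp
    thus "u ^ n + W * ((P * u) ^ n / (1 - P ^ n * W)) = u ^ n / (1 - P ^ n * W)"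
      by (simp add: divide_simps power_mult_distrib) (simp add: algebra_simps)
  qed
  finally show ?thesis unfolding lambert_def by (simp add: sums_iff)
qed

text \<open>
  The bilateral series \<open>\<Sum>n\<in>\<int>. X ^ n / (1 - P ^ n * W)\<close>, which converges for \<open>norm P < norm X < 1\<close>,
  with the geometric part \<open>1 / (1 - X)\<close> split off; the remaining two series converge for
  \<open>norm P < norm X < 1 / norm P\<close>.
\<close>

definition kronecker :: "complex \<Rightarrow> complex \<Rightarrow> complex \<Rightarrow> complex" where
  "kronecker P W X = 1 / (1 - X) + W * lambert P W (P * X) - P / (W * X) * lambert P (P / W) (P / X)"

lemma kronecker_holomorphic:
  assumes P: "norm P < 1" and W: "W \<noteq> 0" and A: "\<And>X. X \<in> A \<Longrightarrow> norm P < norm X \<and> norm P * norm X < 1 \<and> X \<noteq> 1"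
  shows "kronecker P W holomorphic_on A"
proof -
  have A': "X \<noteq> 0" if "X \<in> A" for X
    using A[OF that] by (auto simp: not_less)
  have "lambert P W \<circ> (\<lambda>X. P * X) holomorphic_on A"
    by (rule holomorphic_on_compose_gen[OF _ lambert_holomorphic[OF P]])
       (use A in \<open>auto intro!: holomorphic_intros simp: norm_mult\<close>)
  moreover have "lambert P (P / W) \<circ> (\<lambda>X. P / X) holomorphic_on A"
    by (rule holomorphic_on_compose_gen[OF _ lambert_holomorphic[OF P]])
       (use A A' in \<open>auto intro!: holomorphic_intros simp: norm_divide divide_simps\<close>)
  ultimately show ?thesis
    unfolding kronecker_def o_def using A A' W
    by (intro holomorphic_intros) auto
qed

text \<open>Formally P ^ n / (1 - P ^ n * W) = (1 / (1 - P ^ n * W) - 1) / W, and the bilateral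
  geometric series sums to 0. In the proof one application of \<open>lambert_shift\<close> absorbs
  the term 1 / (1 - P * X), and the other, in the variable 1 / X, produces the term 1 / (1 - X) with
  the factor 1 / W.\<close>

lemma kronecker_shift:
  assumes P: "norm P < 1" "P \<noteq> 0" and W: "\<And>n. P ^ n * W \<noteq> 1" "\<And>n. P ^ Suc n \<noteq> W" "W \<noteq> 0"
    and X: "1 < norm X" "norm P * norm X < 1"
  shows "kronecker P W (P * X) = kronecker P W X / W"
proof -
  have X0: "X \<noteq> 0" "X \<noteq> 1" using X by auto
  have 1: "lambert P W (P * X) = 1 / (1 - P * X) + W * lambert P W (P * (P * X))"
    by (rule lambert_shift) (use P X W in \<open>auto simp: norm_mult\<close>)
  have 2: "lambert P (P / W) (1 / X) = 1 / (1 - 1 / X) + P / W * lambert P (P / W) (P * (1 / X))"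
    by (rule lambert_shift) (use P X W in \<open>auto simp: norm_divide divide_simps mult.commute\<close>)
  have "kronecker P W (P * X) = lambert P W (P * X) - 1 / (W * X) * lambert P (P / W) (1 / X)"
    unfolding kronecker_def using P by (subst 1) simp
  also have "\<dots> = lambert P W (P * X) - 1 / (W * X) / (1 - 1 / X) - P / (W * X) / W * lambert P (P / W) (P / X)"
    by (subst 2) (simp add: algebra_simps)
  also have "1 / (W * X) / (1 - 1 / X) = - 1 / (1 - X) / W"
    using X0 W(3) by (simp add: divide_simps)
  also have "lambert P W (P * X) - - 1 / (1 - X) / W - P / (W * X) / W * lambert P (P / W) (P / X) = kronecker P W X / W"
    unfolding kronecker_def using X0 W(3) by (simp add: field_simps)
  finally show ?thesis .
qed

text \<open>At X = 1 both arguments P * X and P / X equal P, which is inside the unit disc, so the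
  only singular part is the geometric term that was split off.\<close>

lemma kronecker_residue:
  assumes P: "norm P < 1" and W: "W \<noteq> 0"
  shows "((\<lambda>X. (1 - X) * kronecker P W X) \<longlongrightarrow> 1) (at 1)"
proof -
  have "isCont (lambert P V) P" for V
    using holomorphic_on_imp_continuous_on[OF lambert_holomorphic[OF P, of V]] P
    by (simp add: continuous_on_eq_continuous_at)
  \<comment> \<open>The filter \<open>nhds P\<close> rather than \<open>at P\<close> permits
    composition with maps that may take the value P.\<close>
  hence c: "(lambert P V \<longlongrightarrow> lambert P V P) (nhds P)" for V
    by (simp add: isCont_def tendsto_at_iff_tendsto_nhds)
  have "((\<lambda>X. P * X) \<longlongrightarrow> P * 1) (at 1)" "((\<lambda>X. P / X) \<longlongrightarrow> P / 1) (at 1)"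
    by (intro tendsto_intros; simp)+
  hence "((\<lambda>X. lambert P W (P * X)) \<longlongrightarrow> lambert P W P) (at 1)"
        "((\<lambda>X. lambert P (P / W) (P / X)) \<longlongrightarrow> lambert P (P / W) P) (at 1)"
    by (auto intro: filterlim_compose[OF c])
  hence "((\<lambda>X. 1 + (1 - X) * (W * lambert P W (P * X) - P / (W * X) * lambert P (P / W) (P / X))) \<longlongrightarrow>
          1 + (1 - 1) * (W * lambert P W P - P / (W * 1) * lambert P (P / W) P)) (at 1)"
    using W by (intro tendsto_intros) auto
  hence "((\<lambda>X. 1 + (1 - X) * (W * lambert P W (P * X) - P / (W * X) * lambert P (P / W) (P / X))) \<longlongrightarrow> 1) (at 1)"
    by simp
  thus ?thesis
    by (rule Lim_transform_eventually)
       (auto simp: eventually_at_filter kronecker_def algebra_simps)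
qed

text \<open>The factor P / (W * X) and the weight P / W come from the negative indices: for n = -m -
  1, X powi n / (1 - P powi n * W) equals - P / (W * X) * (P / X) ^ m / (1 - P ^ m * (P /
  W)).\<close>

lemma kronecker_sums:
  assumes P: "norm P < 1" "P \<noteq> 0" and W: "\<And>n. P ^ n * W \<noteq> 1" "W \<noteq> 0"
    and X: "norm P < norm X" "norm X < 1"
  shows "(\<lambda>n. X ^ n / (1 - P ^ n * W)) sums lambert P W X"
    and "(\<lambda>n. (P / X) ^ n / (1 - P ^ n * (P / W))) sums lambert P (P / W) (P / X)"
    and "kronecker P W X = lambert P W X - P / (W * X) * lambert P (P / W) (P / X)"
proof -
  have "norm (P / X) < 1" using X by (auto simp: norm_divide divide_simps)
  with X(2) show "(\<lambda>n. X ^ n / (1 - P ^ n * W)) sums lambert P W X"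
     "(\<lambda>n. (P / X) ^ n / (1 - P ^ n * (P / W))) sums lambert P (P / W) (P / X)"
    unfolding lambert_def by (auto intro!: summable_sums summable_lambert P simp del: times_divide_eq_right)
  show "kronecker P W X = lambert P W X - P / (W * X) * lambert P (P / W) (P / X)"
    unfolding kronecker_def using lambert_shift[OF P(1) X(2) W(1)] by simp
qed

subsection \<open>q-Pochhammer symbols\<close>

definition qpoch :: "complex \<Rightarrow> complex \<Rightarrow> complex" where
  "qpoch a t = (\<Prod>n. 1 - a * t ^ n)"

lemma convergent_prod_qpoch:
  fixes a t :: complex
  assumes "norm t < 1"
  shows "convergent_prod (\<lambda>n. 1 - a * t ^ n)"
proof -
  have "summable (\<lambda>n. norm a * norm t ^ n)"
    using assms by (intro summable_mult summable_geometric) auto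
  hence "summable (\<lambda>n. norm (1 - a * t ^ n - 1))"
    by (simp add: norm_mult norm_power)
  thus ?thesis
    using abs_convergent_prod_conv_summable abs_convergent_prod_imp_convergent_prod by blast
qed

lemma qpoch_LIMSEQ:
  assumes "norm t < 1"
  shows "(\<lambda>N. \<Prod>n<N. 1 - a * t ^ n) \<longlonglongrightarrow> qpoch a t"
  unfolding qpoch_def
  using has_prod_imp_tendsto' convergent_prod_has_prod convergent_prod_qpoch[OF assms] by blast

lemma qpoch_nonzero:
  assumes "norm t < 1" "\<And>n. a * t ^ n \<noteq> 1"
  shows "qpoch a t \<noteq> 0"
  unfolding qpoch_def by (rule prodinf_nonzero[OF convergent_prod_qpoch]) (use assms in auto)

lemma qpoch_head:
  assumes "norm t < 1"
  shows "qpoch a t = (1 - a) * qpoch (a * t) t"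
proof (rule LIMSEQ_unique)
  show "(\<lambda>N. \<Prod>n<Suc N. 1 - a * t ^ n) \<longlonglongrightarrow> qpoch a t"
    using qpoch_LIMSEQ[OF assms] by (rule LIMSEQ_Suc)
  have "(\<lambda>N. (1 - a) * (\<Prod>n<N. 1 - a * t * t ^ n)) \<longlonglongrightarrow> (1 - a) * qpoch (a * t) t"
    by (intro tendsto_mult tendsto_const qpoch_LIMSEQ assms)
  thus "(\<lambda>N. \<Prod>n<Suc N. 1 - a * t ^ n) \<longlonglongrightarrow> (1 - a) * qpoch (a * t) t"
    by (subst prod.lessThan_Suc_shift) (simp add: mult.assoc)
qed

text \<open>The partial products converge uniformly on a closed disc about the point, by the M-test.
  Continuity is what the residue of the theta quotient takes from the product.\<close>

lemma qpoch_continuous: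
  assumes "norm t < 1"
  shows "isCont (\<lambda>a. qpoch a t) a"
proof -
  define A where "A = cball a 1"
  have "uniformly_convergent_on A (\<lambda>N a. \<Sum>n<N. norm (1 - a * t ^ n - 1))"
  proof (rule Weierstrass_m_test')
    show "summable (\<lambda>n. (norm a + 1) * norm t ^ n)"
      using assms by (intro summable_mult summable_geometric) auto
    fix n x assume "x \<in> A"
    hence "norm x \<le> norm a + 1"
      using norm_triangle_ineq2[of x a] by (simp add: A_def dist_norm norm_minus_commute)
    thus "norm (norm (1 - x * t ^ n - 1)) \<le> (norm a + 1) * norm t ^ n"
      by (simp add: norm_mult norm_power mult_right_mono)
  qed
  hence "uniformly_convergent_on A (\<lambda>N a. \<Prod>n<N. 1 - a * t ^ n)"
    by (intro uniformly_convergent_on_prod') (auto simp: A_def intro!: continuous_intros)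
  then obtain l where l: "uniform_limit A (\<lambda>N a. \<Prod>n<N. 1 - a * t ^ n) l sequentially"
    by (auto simp: uniformly_convergent_on_def)
  have "l x = qpoch x t" if "x \<in> A" for x
    using tendsto_uniform_limitI[OF l that] qpoch_LIMSEQ[OF assms] LIMSEQ_unique by blast
  moreover have "continuous_on A l"
    by (rule uniform_limit_theorem[OF _ l]) (auto intro!: continuous_intros always_eventually)
  ultimately have "continuous_on A (\<lambda>a. qpoch a t)"
    by (simp cong: continuous_on_cong)
  thus ?thesis
    by (rule continuous_on_interior) (simp add: A_def)
qed

text \<open>The factors of \<open>qpoch t t\<close> are sorted by odd and even powers of t. Together
  with \<open>qpoch_mult_uminus\<close> this yields Euler's identity between odd parts and distinct
  parts.\<close>

lemma qpoch_odd_even: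
  assumes t: "norm t < 1"
  shows "qpoch t (t ^ 2) * qpoch (t ^ 2) (t ^ 2) = qpoch t t"
proof (rule LIMSEQ_unique)
  have t2: "norm (t ^ 2) < 1" using t by (simp add: norm_power power_less_one_iff)
  show "(\<lambda>N. (\<Prod>n<N. 1 - t * (t ^ 2) ^ n) * (\<Prod>n<N. 1 - t ^ 2 * (t ^ 2) ^ n)) \<longlonglongrightarrow> qpoch t (t ^ 2) * qpoch (t ^ 2) (t ^ 2)"
    by (intro tendsto_mult qpoch_LIMSEQ t2)
  have "(\<Prod>n<N. 1 - t * (t ^ 2) ^ n) * (\<Prod>n<N. 1 - t ^ 2 * (t ^ 2) ^ n) = (\<Prod>n<2 * N. 1 - t * t ^ n)" for N
  proof (induction N)
    case (Suc N)
    have "1 - t * (t ^ 2) ^ N = 1 - t * t ^ (2 * N)" "1 - t ^ 2 * (t ^ 2) ^ N = 1 - t * t ^ Suc (2 * N)"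
      by (simp_all only: power_mult power_Suc power2_eq_square mult.assoc)
    thus ?case
      using Suc.IH by (simp add: mult_ac)
  qed simp
  moreover have "(\<lambda>N. \<Prod>n<2 * N. 1 - t * t ^ n) \<longlonglongrightarrow> qpoch t t"
    using filterlim_compose[OF qpoch_LIMSEQ[OF t], of "\<lambda>N. 2 * N" sequentially t]
    by (simp add: filterlim_subseq strict_mono_def)
  ultimately show "(\<lambda>N. (\<Prod>n<N. 1 - t * (t ^ 2) ^ n) * (\<Prod>n<N. 1 - t ^ 2 * (t ^ 2) ^ n)) \<longlonglongrightarrow> qpoch t t"
    by simp
qed

lemma qpoch_mult_uminus:
  assumes t: "norm t < 1"
  shows "qpoch a t * qpoch (- a) t = qpoch (a ^ 2) (t ^ 2)"
proof (rule LIMSEQ_unique)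
  have t2: "norm (t ^ 2) < 1" using t by (simp add: norm_power power_less_one_iff)
  show "(\<lambda>N. (\<Prod>n<N. 1 - a * t ^ n) * (\<Prod>n<N. 1 - (- a) * t ^ n)) \<longlonglongrightarrow> qpoch a t * qpoch (- a) t"
    by (intro tendsto_mult qpoch_LIMSEQ t)
  have "(\<Prod>n<N. 1 - a * t ^ n) * (\<Prod>n<N. 1 - (- a) * t ^ n) = (\<Prod>n<N. 1 - a ^ 2 * (t ^ 2) ^ n)" for N
    by (simp flip: prod.distrib)
       (simp add: algebra_simps power2_eq_square power_mult_distrib)
  thus "(\<lambda>N. (\<Prod>n<N. 1 - a * t ^ n) * (\<Prod>n<N. 1 - (- a) * t ^ n)) \<longlonglongrightarrow> qpoch (a ^ 2) (t ^ 2)"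
    using qpoch_LIMSEQ[OF t2, of "a ^ 2"] by simp
qed

section \<open>Bilateral sums over the integers\<close>

lemma range_int_Un: "range int \<union> range (\<lambda>n. - int n - 1) = UNIV"
proof -
  have "k \<in> range int \<union> range (\<lambda>n. - int n - 1)" for k
    by (cases k rule: int_cases) auto
  thus ?thesis by blast
qed

lemma has_sum_int_split:
  fixes f :: "int \<Rightarrow> complex"
  assumes "(f has_sum S) UNIV"
  obtains A B where "(\<lambda>n. f (int n)) sums A" "(\<lambda>n. f (- int n - 1)) sums B" "S = A + B"
proof -
  have s: "f summable_on A" for A
    using assms summable_on_subset_banach[of f UNIV A] has_sum_imp_summable by blast
  obtain a b where ab: "(f has_sum a) (range int)" "(f has_sum b) (range (\<lambda>n. - int n - 1))"
    using s summable_on_def by metis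
  have "(f has_sum (a + b)) (range int \<union> range (\<lambda>n. - int n - 1))"
    by (rule has_sum_Un_disjoint[OF ab]) auto
  hence "S = a + b"
    using assms has_sum_unique unfolding range_int_Un by blast
  moreover have "((f \<circ> int) has_sum a) UNIV" "((f \<circ> (\<lambda>n. - int n - 1)) has_sum b) UNIV"
    using ab by (simp_all add: has_sum_reindex inj_on_def)
  hence "(\<lambda>n. f (int n)) sums a" "(\<lambda>n. f (- int n - 1)) sums b"
    unfolding o_def by (auto intro: has_sum_imp_sums)
  ultimately show ?thesis
    using that by blast
qed

text \<open>Pairing n with -n - 1 is symmetric about -1/2, as required by the half-integer exponents
  of \<open>theta1\<close> and \<open>theta2\<close>.\<close>

lemma has_sum_int_imp_sums:
  fixes f :: "int \<Rightarrow> complex"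
  assumes "(f has_sum S) UNIV"
  shows "(\<lambda>n. f (int n) + f (- int n - 1)) sums S"
proof -
  obtain A B where "(\<lambda>n. f (int n)) sums A" "(\<lambda>n. f (- int n - 1)) sums B" "S = A + B"
    using has_sum_int_split[OF assms] by blast
  thus ?thesis by (simp add: sums_add)
qed

text \<open>Pairing n with -n leaves the index 0 alone, which is the constant 1 in
  \<open>theta3\<close> and \<open>theta4\<close>.\<close>

lemma has_sum_int_imp_sums':
  fixes f :: "int \<Rightarrow> complex"
  assumes "(f has_sum S) UNIV"
  shows "(\<lambda>n. f (int (Suc n)) + f (- int (Suc n))) sums (S - f 0)"
proof -
  obtain A B where AB: "(\<lambda>n. f (int n)) sums A" "(\<lambda>n. f (- int n - 1)) sums B" "S = A + B"
    using has_sum_int_split[OF assms] by blast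
  have "(\<lambda>n. f (int (Suc n))) sums (A - f 0)"
    using AB(1) by (subst sums_Suc_iff) simp
  moreover have "- int n - 1 = - int (Suc n)" for n by simp
  ultimately have "(\<lambda>n. f (int (Suc n)) + f (- int (Suc n))) sums (A - f 0 + B)"
    using AB(2) by (simp only: sums_add)
  thus ?thesis
    using AB(3) by (simp add: algebra_simps)
qed

subsection \<open>A two-variable theta function\<close>

text \<open>The general term of \<open>theta4\<close> with y = exp (2 * \<i> * v). The other three
  theta functions arise by replacing y with -y or with plus or minus q * y, up to a prefactor, so
  integer powers suffice and fractional powers of q stay outside the sum.\<close>

definition jterm :: "complex \<Rightarrow> complex \<Rightarrow> int \<Rightarrow> complex" where
  "jterm q y k = q powi (k * k) * (- y) powi k"

definition jtheta :: "complex \<Rightarrow> complex \<Rightarrow> complex" where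
  "jtheta q y = infsum (jterm q y) UNIV"

text \<open>The term is the n-th power of a ^ n * r, and this base tends to 0.\<close>

lemma summable_gauss:
  fixes a r :: real
  assumes "0 \<le> a" "a < 1" "0 \<le> r"
  shows "summable (\<lambda>n. a ^ (n * n) * r ^ n)"
proof -
  have "(\<lambda>n. a ^ n * r) \<longlonglongrightarrow> 0 * r"
    by (intro tendsto_mult tendsto_const LIMSEQ_power_zero) (use assms in auto)
  hence "eventually (\<lambda>n. a ^ n * r < 1/2) sequentially"
    by (rule order_tendstoD) auto
  then obtain N where N: "\<And>n. n \<ge> N \<Longrightarrow> a ^ n * r < 1/2"
    by (auto simp: eventually_sequentially)
  show ?thesis
  proof (rule summable_comparison_test'[where N = N])
    show "summable (\<lambda>n. (1/2 :: real) ^ n)"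
      by (intro summable_geometric) auto
    fix n assume "n \<ge> N"
    hence "(a ^ n * r) ^ n \<le> (1/2) ^ n"
      using N[of n] assms by (intro power_mono) auto
    thus "norm (a ^ (n * n) * r ^ n) \<le> (1/2) ^ n"
      using assms by (simp add: power_mult power_mult_distrib)
  qed
qed

lemma jterm_of_nat: "jterm q y (int n) = q ^ (n * n) * (- y) ^ n"
  by (simp add: jterm_def flip: of_nat_mult)

lemma jterm_uminus: "jterm q y (- k) = jterm q (1 / y) k"
proof -
  have "- (1 / y) = inverse (- y)"
    by (simp add: inverse_eq_divide)
  hence "(- y) powi (- k) = (- (1 / y)) powi k"
    by (simp only: power_int_minus power_int_inverse)
  thus ?thesis
    by (simp add: jterm_def)
qed

lemma summable_norm_jterm:
  assumes "norm q < 1"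
  shows "summable (\<lambda>n. norm (jterm q y (int n)))"
  using summable_gauss[of "norm q" "norm y"] assms
  by (simp add: jterm_of_nat norm_mult norm_power)

lemma summable_norm_jterm':
  assumes "norm q < 1"
  shows "summable (\<lambda>n. norm (jterm q y (- int n - 1)))"
proof -
  have "- int n - 1 = - int (Suc n)" for n by simp
  thus ?thesis
    using summable_norm_jterm[OF assms(1), of "1 / y"] 
    by (simp only: jterm_uminus summable_Suc_iff[of "\<lambda>n. norm (jterm q (1 / y) (int n))"])
qed

lemma jtheta_has_sum:
  assumes "norm q < 1"
  shows "(jterm q y has_sum jtheta q y) UNIV"
proof -
  have "jterm q y summable_on range int"
    using norm_summable_imp_summable_on[OF summable_norm_jterm[OF assms(1), of y]]
    by (subst summable_on_reindex) (auto simp: o_def)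
  moreover have "jterm q y summable_on range (\<lambda>n. - int n - 1)"
    using norm_summable_imp_summable_on[OF summable_norm_jterm'[OF assms]]
    by (subst summable_on_reindex) (auto simp: o_def inj_on_def)
  ultimately have "jterm q y summable_on (range int \<union> range (\<lambda>n. - int n - 1))"
    by (rule summable_on_union)
  thus ?thesis
    by (simp add: jtheta_def range_int_Un)
qed

text \<open>Completing the square turns a shift of the index into a power of q. The same relations
  give the quasi-period of \<open>jtheta\<close> and the recursion behind the finite triple
  product.\<close>

lemma jterm_shift:
  assumes "q \<noteq> 0" "y \<noteq> 0"
  shows "- y * jterm q y (k - 1) = q powi (1 - 2 * k) * jterm q y k"
    and "- 1 / y * jterm q y (k + 1) = q powi (1 + 2 * k) * jterm q y k"
proof -
  have "(k - 1) * (k - 1) = k * k + (1 - 2 * k)" "(k + 1) * (k + 1) = k * k + (1 + 2 * k)"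
    by (simp_all add: algebra_simps)
  thus "- y * jterm q y (k - 1) = q powi (1 - 2 * k) * jterm q y k"
    "- 1 / y * jterm q y (k + 1) = q powi (1 + 2 * k) * jterm q y k"
    using assms unfolding jterm_def
    by (simp_all only: power_int_add[OF disjI1] power_int_diff[OF disjI1] power_int_1_right neg_equal_0_iff_equal not_False_eq_True)
       (simp_all add: field_simps)
qed

lemma has_sum_int_translate:
  fixes f :: "int \<Rightarrow> complex"
  assumes "(f has_sum S) UNIV"
  shows "((\<lambda>k. f (k + c)) has_sum S) UNIV"
proof -
  have "bij_betw (\<lambda>k. k + c) UNIV UNIV"
    by (rule bij_betwI[of _ _ _ "\<lambda>k. k - c"]) auto
  from has_sum_reindex_bij_betw[OF this, of f S] show ?thesis
    using assms by blast
qed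

lemma jtheta_shift:
  assumes "norm q < 1" "q \<noteq> 0" "y \<noteq> 0"
  shows "jtheta q (q ^ 2 * y) = - jtheta q y / (q * y)"
proof -
  have "((\<lambda>k. jterm q y (k + 1)) has_sum jtheta q y) UNIV"
    by (intro has_sum_int_translate jtheta_has_sum assms)
  from has_sum_cmult_right[OF this, of "- 1 / (q * y)"]
  have "((\<lambda>k. - 1 / (q * y) * jterm q y (k + 1)) has_sum (- 1 / (q * y) * jtheta q y)) UNIV" .
  also have "(\<lambda>k. - 1 / (q * y) * jterm q y (k + 1)) = jterm q (q ^ 2 * y)"
  proof
    fix k
    have "- 1 / (q * y) * jterm q y (k + 1) = 1 / q * (- 1 / y * jterm q y (k + 1))"
      by simp
    also have "\<dots> = 1 / q * (q powi (1 + 2 * k) * jterm q y k)"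
      by (subst jterm_shift) (use assms in auto)
    also have "\<dots> = q powi (2 * k) * jterm q y k"
      using assms by (simp add: power_int_add)
    also have "\<dots> = jterm q (q ^ 2 * y) k"
    proof -
      have "(- (q ^ 2 * y)) powi k = (q ^ 2) powi k * (- y) powi k"
        by (simp only: minus_mult_right power_int_mult_distrib)
      thus ?thesis
        by (simp add: jterm_def power_int_power)
    qed
    finally show "- 1 / (q * y) * jterm q y (k + 1) = jterm q (q ^ 2 * y) k" .
  qed
  finally show ?thesis
    using assms by (simp add: jtheta_def infsumI)
qed

text \<open>The Laurent series is split into one entire function F evaluated at -y and at -1 / y.
  The index 0 occurs in both halves, hence the correction by -1.\<close>

lemma jtheta_holomorphic:
  assumes "norm q < 1"
  shows "jtheta q holomorphic_on - {0}"
proof -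
  define F where "F = (\<lambda>u. \<Sum>n. q ^ (n * n) * u ^ n)"
  have sF: "summable (\<lambda>n. q ^ (n * n) * u ^ n)" for u
    using summable_norm_cancel[OF summable_norm_jterm[OF assms, of "-u"]]
    by (simp add: jterm_of_nat)
  have F: "F holomorphic_on ball 0 r" for r
    by (rule power_series_holomorphic[where a = "\<lambda>n. q ^ (n * n)"])
       (use sF in \<open>auto simp: F_def summable_sums\<close>)
  have "F field_differentiable (at u)" for u
    using F[of "norm u + 1"] by (simp add: holomorphic_on_open field_differentiable_def)
  hence F': "F holomorphic_on UNIV"
    by (simp add: holomorphic_on_def)
  have "jtheta q y = F (- y) + F (- 1 / y) - 1" if "y \<noteq> 0" for y
  proof -
    obtain A B where AB: "(\<lambda>n. jterm q y (int n)) sums A" "(\<lambda>n. jterm q y (- int n - 1)) sums B"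
      "jtheta q y = A + B"
      using has_sum_int_split[OF jtheta_has_sum[OF assms]] by metis
    have "A = F (- y)"
      using AB(1) by (simp add: sums_iff F_def jterm_of_nat)
    moreover have "(\<lambda>n. q ^ (Suc n * Suc n) * (- 1 / y) ^ Suc n) sums B"
    proof -
      have "jterm q y (- int n - 1) = q ^ (Suc n * Suc n) * (- 1 / y) ^ Suc n" for n
      proof -
        have "- int n - 1 = - int (Suc n)" by simp
        thus ?thesis using that by (simp only: jterm_uminus jterm_of_nat) simp
      qed
      thus ?thesis using AB(2) by simp
    qed
    hence "(\<lambda>n. q ^ (n * n) * (- 1 / y) ^ n) sums (B + 1)"
      using sums_Suc_iff[of "\<lambda>n. q ^ (n * n) * (- 1 / y) ^ n" "B"] by simp
    hence "B = F (- 1 / y) - 1"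
      by (simp add: sums_iff F_def)
    ultimately show ?thesis using AB by simp
  qed
  moreover have "(\<lambda>y. F (- y) + F (- 1 / y) - 1) holomorphic_on - {0}"
  proof -
    have "F \<circ> uminus holomorphic_on - {0}" "F \<circ> (\<lambda>y. - 1 / y) holomorphic_on - {0}"
      by (rule holomorphic_on_compose_gen[OF _ F']; auto intro!: holomorphic_intros)+
    thus ?thesis
      unfolding o_def by (intro holomorphic_intros)
  qed
  ultimately show ?thesis
    by (subst holomorphic_cong[OF refl]) auto
qed

subsection \<open>The triple product\<close>

text \<open>
  Reciprocals \<open>1 / (t; t)\<^sub>k\<close>, with the value \<open>0\<close> for negative \<open>k\<close>; with this convention the
  recurrence of the Gaussian binomial coefficients needs no boundary cases.
\<close>

definition rec_qpoch :: "complex \<Rightarrow> int \<Rightarrow> complex" where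
  "rec_qpoch t k = (if k < 0 then 0 else 1 / (\<Prod>n<nat k. 1 - t * t ^ n))"

lemma power_ne_1:
  fixes t :: complex
  assumes "norm t < 1"
  shows "t * t ^ n \<noteq> 1"
proof
  assume "t * t ^ n = 1"
  hence "norm t ^ Suc n = 1"
    by (metis norm_one norm_power power_Suc)
  thus False
    using assms power_less_one_iff[of "norm t" "Suc n"] by simp
qed

text \<open>The critical case is k = 0: the factor 1 - t powi 0 vanishes and matches the value 0
  assigned to the index -1.\<close>

lemma rec_qpoch_pred:
  assumes "norm t < 1" "t \<noteq> 0"
  shows "rec_qpoch t (k - 1) = (1 - t powi k) * rec_qpoch t k"
proof -
  consider "k < 0" | "k = 0" | n where "k = int (Suc n)"
    by (metis linorder_neqE_linordered_idom zero_less_imp_eq_int gr0_conv_Suc)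
  thus ?thesis
  proof cases
    case 3
    have "1 - t * t ^ n \<noteq> 0"
      using power_ne_1[OF assms(1), of n] by simp
    moreover have "nat k = Suc n" "nat (k - 1) = n" "t powi k = t * t ^ n"
      using 3 by (simp_all only: nat_int power_int_of_nat power_Suc)
    ultimately show ?thesis
      using 3 by (simp add: rec_qpoch_def)
  qed (auto simp: rec_qpoch_def)
qed

text \<open>
  The Gaussian binomial coefficient of \<open>2 * N\<close> over \<open>N + k\<close> in base \<open>t\<close>.
\<close>

definition jcoeff :: "complex \<Rightarrow> nat \<Rightarrow> int \<Rightarrow> complex" where
  "jcoeff t N k = (\<Prod>n<2 * N. 1 - t * t ^ n) * (rec_qpoch t (int N - k) * rec_qpoch t (int N + k))"

text \<open>This is the Pascal rule for Gaussian binomials applied twice, in the form needed to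
  multiply by both new factors of the product at once. Written in a = t powi (N - k), b = t powi (N
  + k) and the outermost reciprocals R and S, it is a polynomial identity, since t ^ (2 * N) = a *
  b.\<close>

lemma jcoeff_Suc:
  assumes t: "norm t < 1" "t \<noteq> 0"
  shows "jcoeff t (Suc N) k = (1 + t ^ (2 * N + 1)) * jcoeff t N k
    + t powi (int N + 1 - k) * jcoeff t N (k - 1) + t powi (int N + 1 + k) * jcoeff t N (k + 1)"
proof -
  define A B where "A = int N - k" and "B = int N + k"
  define a b where "a = t powi A" and "b = t powi B"
  define R S where "R = rec_qpoch t (A + 1)" and "S = rec_qpoch t (B + 1)"
  have a1: "t powi (A + 1) = t * a" and b1: "t powi (B + 1) = t * b"
    using t by (simp_all add: a_def b_def power_int_add)
  have ab: "t ^ (2 * N) = a * b"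
    using t by (simp add: a_def b_def A_def B_def flip: power_int_add power_int_of_nat)
  have R0: "rec_qpoch t A = (1 - t * a) * R" and S0: "rec_qpoch t B = (1 - t * b) * S"
    using rec_qpoch_pred[OF t, of "A + 1"] rec_qpoch_pred[OF t, of "B + 1"] by (simp_all add: R_def S_def a1 b1)
  have R1: "rec_qpoch t (A - 1) = (1 - a) * ((1 - t * a) * R)" and S1: "rec_qpoch t (B - 1) = (1 - b) * ((1 - t * b) * S)"
    using rec_qpoch_pred[OF t, of A] rec_qpoch_pred[OF t, of B] by (simp_all add: R0 S0 a_def b_def)
  define Q where "Q = (\<Prod>n<2 * N. 1 - t * t ^ n)"
  have J0: "jcoeff t N k = Q * (rec_qpoch t A * rec_qpoch t B)"
    by (simp add: jcoeff_def Q_def A_def B_def)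
  have J1: "jcoeff t N (k - 1) = Q * (R * rec_qpoch t (B - 1))"
    by (simp add: jcoeff_def Q_def A_def B_def R_def algebra_simps)
  have J2: "jcoeff t N (k + 1) = Q * (rec_qpoch t (A - 1) * S)"
    by (simp add: jcoeff_def Q_def A_def B_def S_def algebra_simps)
  have J3: "jcoeff t (Suc N) k = Q * (1 - t * (a * b)) * (1 - t * (t * (a * b))) * (R * S)"
    by (simp add: jcoeff_def Q_def A_def B_def R_def S_def algebra_simps flip: ab)
  have e: "t ^ (2 * N + 1) = t * (a * b)" "int N + 1 - k = A + 1" "int N + 1 + k = B + 1"
    by (simp_all add: ab A_def B_def)
  show ?thesis
    unfolding J0 J1 J2 J3 e a1 b1 R0 S0 R1 S1 by algebra
qed

text \<open>With c = q ^ (2 * N + 1) the two new factors multiply to 1 + c ^ 2 - c * y - c / y, so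
  the induction step combines the sum with its two neighbouring translates. Summing over all
  integers makes these translates mere reindexings.\<close>

lemma finite_triple_product:
  assumes q: "norm q < 1" "q \<noteq> 0" and y: "y \<noteq> 0"
  shows "((\<lambda>k. jcoeff (q ^ 2) N k * jterm q y k) has_sum
           (\<Prod>n<N. (1 - y * q * (q ^ 2) ^ n) * (1 - q / y * (q ^ 2) ^ n))) UNIV"
proof (induction N)
  case 0
  show ?case
    \<comment> \<open>For N = 0 and k nonzero, one of the indices -k and k is negative, so the
      coefficient is 0.\<close>
    by (rule has_sum_finite_neutralI[where B = "{0}"]) (auto simp: jcoeff_def rec_qpoch_def jterm_def)
next
  case (Suc N)
  define t where "t = q ^ 2"
  define f where "f = (\<lambda>k. jcoeff t N k * jterm q y k)"
  define F where "F = (\<Prod>n<N. (1 - y * q * t ^ n) * (1 - q / y * t ^ n))"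
  define c where "c = q ^ (2 * N + 1)"
  have t: "norm t < 1" "t \<noteq> 0"
    using q by (auto simp: t_def norm_power power_less_one_iff)
  have f: "(f has_sum F) UNIV"
    using Suc.IH by (simp add: f_def F_def t_def)
  have f1: "((\<lambda>k. f (k - 1)) has_sum F) UNIV"
    using has_sum_int_translate[OF f, of "- 1"] by simp
  have f2: "((\<lambda>k. f (k + 1)) has_sum F) UNIV"
    by (rule has_sum_int_translate[OF f])
  have "((\<lambda>k. (1 + c ^ 2) * f k + c * (- y) * f (k - 1) + c * (- 1 / y) * f (k + 1)) has_sum
          ((1 + c ^ 2) * F + c * (- y) * F + c * (- 1 / y) * F)) UNIV"
    by (intro has_sum_add has_sum_cmult_right f f1 f2)
  also have "(1 + c ^ 2) * F + c * (- y) * F + c * (- 1 / y) * F = F * ((1 - y * c) * (1 - c / y))"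
    using y by (simp add: field_simps power2_eq_square)
  also have "c = q * t ^ N"
    by (simp add: c_def t_def flip: power_mult)
  also have "F * ((1 - y * (q * t ^ N)) * (1 - q * t ^ N / y)) =
      (\<Prod>n<Suc N. (1 - y * q * t ^ n) * (1 - q / y * t ^ n))"
    by (simp add: F_def mult.assoc)
  also have "(\<lambda>k. (1 + (q * t ^ N) ^ 2) * f k + q * t ^ N * (- y) * f (k - 1) + q * t ^ N * (- 1 / y) * f (k + 1)) =
      (\<lambda>k. jcoeff t (Suc N) k * jterm q y k)"
  proof
    fix k
    have p1: "q * t ^ N * q powi (1 - 2 * k) = t powi (int N + 1 - k)"
    proof -
      have "q * t ^ N * q powi (1 - 2 * k) = q powi (1 + 2 * int N + (1 - 2 * k))"
        using q by (simp only: power_int_add[OF disjI1] not_False_eq_True power_int_1_right t_def power_int_mult power_int_of_nat power_int_numeral)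
      also have "1 + 2 * int N + (1 - 2 * k) = int 2 * (int N + 1 - k)" by simp
      finally show ?thesis by (simp only: t_def power_int_power)
    qed
    have p2: "q * t ^ N * q powi (1 + 2 * k) = t powi (int N + 1 + k)"
    proof -
      have "q * t ^ N * q powi (1 + 2 * k) = q powi (1 + 2 * int N + (1 + 2 * k))"
        using q by (simp only: power_int_add[OF disjI1] not_False_eq_True power_int_1_right t_def power_int_mult power_int_of_nat power_int_numeral)
      also have "1 + 2 * int N + (1 + 2 * k) = int 2 * (int N + 1 + k)" by simp
      finally show ?thesis by (simp only: t_def power_int_power)
    qed
    have p0: "(q * t ^ N) ^ 2 = t ^ (2 * N + 1)"
      by (simp add: t_def power_mult_distrib flip: power_mult)
    have "q * t ^ N * (- y) * f (k - 1) = q * t ^ N * jcoeff t N (k - 1) * (- y * jterm q y (k - 1))"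
      by (simp add: f_def)
    also have "\<dots> = t powi (int N + 1 - k) * jcoeff t N (k - 1) * jterm q y k"
      unfolding jterm_shift(1)[OF q(2) y] p1[symmetric] by simp
    finally have 1: "q * t ^ N * (- y) * f (k - 1) = t powi (int N + 1 - k) * jcoeff t N (k - 1) * jterm q y k" .
    have "q * t ^ N * (- 1 / y) * f (k + 1) = q * t ^ N * jcoeff t N (k + 1) * (- 1 / y * jterm q y (k + 1))"
      by (simp add: f_def)
    also have "\<dots> = t powi (int N + 1 + k) * jcoeff t N (k + 1) * jterm q y k"
      unfolding jterm_shift(2)[OF q(2) y] p2[symmetric] by simp
    finally have 2: "q * t ^ N * (- 1 / y) * f (k + 1) = t powi (int N + 1 + k) * jcoeff t N (k + 1) * jterm q y k" .
    show "(1 + (q * t ^ N) ^ 2) * f k + q * t ^ N * (- y) * f (k - 1) + q * t ^ N * (- 1 / y) * f (k + 1) =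
        jcoeff t (Suc N) k * jterm q y k"
      unfolding 1 2 p0 jcoeff_Suc[OF t] by (simp add: f_def algebra_simps)
  qed
  finally show ?case
    by (simp add: t_def)
qed

lemma rec_qpoch_tendsto:
  assumes "norm t < 1"
  shows "(\<lambda>n. rec_qpoch t (int n)) \<longlonglongrightarrow> 1 / qpoch t t"
proof -
  have "qpoch t t \<noteq> 0"
    by (rule qpoch_nonzero[OF assms power_ne_1[OF assms]])
  hence "(\<lambda>N. 1 / (\<Prod>n<N. 1 - t * t ^ n)) \<longlonglongrightarrow> 1 / qpoch t t"
    by (intro tendsto_divide tendsto_const qpoch_LIMSEQ assms)
  thus ?thesis by (simp add: rec_qpoch_def)
qed

lemma jcoeff_tendsto:
  assumes "norm t < 1"
  shows "(\<lambda>N. jcoeff t N k) \<longlonglongrightarrow> 1 / qpoch t t"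
proof -
  have Q: "qpoch t t \<noteq> 0"
    by (rule qpoch_nonzero[OF assms power_ne_1[OF assms]])
  have *: "(\<lambda>N. rec_qpoch t (int N + k)) \<longlonglongrightarrow> 1 / qpoch t t" for k
  proof -
    have "filterlim (\<lambda>N. nat (int N + k)) at_top sequentially"
    proof (rule filterlim_at_top_mono)
      show "filterlim (\<lambda>N. N - nat (- k)) at_top sequentially"
        by (rule filterlim_minus_const_nat_at_top)
      show "eventually (\<lambda>N. N - nat (- k) \<le> nat (int N + k)) sequentially"
        by (intro always_eventually) auto
    qed
    hence "(\<lambda>N. rec_qpoch t (int (nat (int N + k)))) \<longlonglongrightarrow> 1 / qpoch t t"
      by (rule filterlim_compose[OF rec_qpoch_tendsto[OF assms]])
    moreover have "eventually (\<lambda>N. rec_qpoch t (int (nat (int N + k))) = rec_qpoch t (int N + k)) sequentially"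
      using eventually_ge_at_top[of "nat (- k)"]
    proof eventually_elim
      case (elim N)
      hence "0 \<le> int N + k" by linarith
      thus ?case by simp
    qed
    ultimately show ?thesis
      by (rule Lim_transform_eventually)
  qed
  have "(\<lambda>N. \<Prod>n<2 * N. 1 - t * t ^ n) \<longlonglongrightarrow> qpoch t t"
    using filterlim_compose[OF qpoch_LIMSEQ[OF assms], of "\<lambda>N. 2 * N" sequentially t]
    by (simp add: filterlim_subseq strict_mono_def)
  hence "(\<lambda>N. jcoeff t N k) \<longlonglongrightarrow> qpoch t t * (1 / qpoch t t * (1 / qpoch t t))"
    unfolding jcoeff_def
    using *[of k] *[of "- k"] by (intro tendsto_mult) simp_all
  thus ?thesis using Q by simp
qed

text \<open>The bound is uniform in both N and k; it provides the majorant for exchanging limit and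
  sum in the triple product.\<close>

lemma jcoeff_bounded:
  assumes "norm t < 1"
  obtains M where "\<And>N k. norm (jcoeff t N k) \<le> M"
proof -
  have "Bseq (\<lambda>n. rec_qpoch t (int n))" "Bseq (\<lambda>N. \<Prod>n<N. 1 - t * t ^ n)"
    using rec_qpoch_tendsto[OF assms] qpoch_LIMSEQ[OF assms] convergentI convergent_imp_Bseq by blast+
  then obtain B C where B: "\<And>n. norm (rec_qpoch t (int n)) \<le> B" and C: "\<And>N. norm (\<Prod>n<N. 1 - t * t ^ n) \<le> C"
    unfolding Bseq_def by blast
  have B0: "0 \<le> B" and C0: "0 \<le> C"
    using B[of 0] C[of 0] norm_ge_zero order_trans by blast+
  have B': "norm (rec_qpoch t k) \<le> B" for k
    using B[of "nat k"] B0 by (cases "k < 0") (auto simp: rec_qpoch_def)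
  have "norm (jcoeff t N k) \<le> C * (B * B)" for N k
    unfolding jcoeff_def norm_mult by (intro mult_mono B' C B0 C0 mult_nonneg_nonneg norm_ge_zero)
  thus ?thesis using that by blast
qed

text \<open>For fixed k the Gaussian binomials tend to 1 / \<open>qpoch t t\<close>, and Tannery's
  theorem passes this through the finite identity. The integer sum is folded into a sum over the
  naturals, n with -n - 1, to apply it.\<close>

theorem jacobi_triple_product:
  assumes q: "norm q < 1" "q \<noteq> 0" and y: "y \<noteq> 0"
  shows "jtheta q y = qpoch (q ^ 2) (q ^ 2) * (qpoch (y * q) (q ^ 2) * qpoch (q / y) (q ^ 2))"
proof -
  define t where "t = q ^ 2"
  have t: "norm t < 1"
    using q by (auto simp: t_def norm_power power_less_one_iff)
  have Q: "qpoch t t \<noteq> 0"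
    by (rule qpoch_nonzero[OF t power_ne_1[OF t]])
  define P where "P = (\<lambda>N. \<Prod>n<N. (1 - y * q * t ^ n) * (1 - q / y * t ^ n))"
  obtain M where M: "\<And>N k. norm (jcoeff t N k) \<le> M"
    using jcoeff_bounded[OF t] by blast
  define g where "g = (\<lambda>n N. jcoeff t N (int n) * jterm q y (int n) + jcoeff t N (- int n - 1) * jterm q y (- int n - 1))"
  define h where "h = (\<lambda>n. 1 / qpoch t t * jterm q y (int n) + 1 / qpoch t t * jterm q y (- int n - 1))"
  define m where "m = (\<lambda>n. M * norm (jterm q y (int n)) + M * norm (jterm q y (- int n - 1)))"
  have "norm (g n N) \<le> m n" for n N
    unfolding g_def m_def
    by (intro order_trans[OF norm_triangle_ineq] add_mono) (auto simp: norm_mult intro!: mult_right_mono M)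
  moreover have "summable m"
    unfolding m_def by (intro summable_add summable_mult summable_norm_jterm summable_norm_jterm' q)
  moreover have "(\<lambda>N. g n N) \<longlonglongrightarrow> h n" for n
    unfolding g_def h_def by (intro tendsto_intros jcoeff_tendsto t)
  ultimately have "(\<lambda>N. \<Sum>n. g n N) \<longlonglongrightarrow> (\<Sum>n. h n)"
    by (intro tannerys_theorem[of g h sequentially m, THEN conjunct2, THEN conjunct2]) (auto simp: case_prod_unfold)
  moreover have "(\<Sum>n. g n N) = P N" for N
    using has_sum_int_imp_sums[OF finite_triple_product[OF q y, of N]]
    by (simp add: g_def P_def t_def sums_iff)
  moreover have "P \<longlonglongrightarrow> qpoch (y * q) t * qpoch (q / y) t"
    unfolding P_def prod.distrib by (intro tendsto_mult qpoch_LIMSEQ t)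
  ultimately have "(\<Sum>n. h n) = qpoch (y * q) t * qpoch (q / y) t"
    using LIMSEQ_unique by auto
  moreover have "h sums (1 / qpoch t t * jtheta q y)"
    using has_sum_int_imp_sums[OF has_sum_cmult_right[OF jtheta_has_sum[OF q(1)], of "1 / qpoch t t" y]]
    by (simp add: h_def)
  ultimately show ?thesis
    using Q by (simp add: sums_iff t_def field_simps)
qed

lemma jtheta_nonzero:
  assumes q: "norm q < 1" "q \<noteq> 0" and y: "y \<noteq> 0"
    and "\<And>n. y * q * (q ^ 2) ^ n \<noteq> 1" "\<And>n. q / y * (q ^ 2) ^ n \<noteq> 1"
  shows "jtheta q y \<noteq> 0"
proof -
  have t: "norm (q ^ 2) < 1"
    using q by (auto simp: norm_power power_less_one_iff)
  show ?thesis
    unfolding jacobi_triple_product[OF q y]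
    using qpoch_nonzero[OF t] power_ne_1[OF t] assms by simp
qed

text \<open>
  With \<open>q\<close> the nome, this is Jacobi's identity \<open>\<theta>\<^sub>1' = \<theta>\<^sub>2 \<theta>\<^sub>3 \<theta>\<^sub>4\<close>, the derivative at \<open>0\<close> being replaced by
  its product.
\<close>

lemma jtheta_derivative_formula:
  assumes q: "norm q < 1" "q \<noteq> 0"
  shows "jtheta q 1 * jtheta q (- 1) * jtheta q (- q) = 2 * qpoch (q ^ 2) (q ^ 2) ^ 3"
proof -
  define t where "t = q ^ 2"
  have t: "norm t < 1" "t \<noteq> 0"
    using q by (auto simp: t_def norm_power power_less_one_iff)
  have t2: "norm (t ^ 2) < 1"
    using t by (auto simp: norm_power power_less_one_iff)
  define Q where "Q = qpoch t t"
  define B where "B = qpoch (- t) t"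
  define O1 where "O1 = qpoch t (t ^ 2)"
  define E1 where "E1 = qpoch (t ^ 2) (t ^ 2)"
  have Q0: "Q \<noteq> 0"
    unfolding Q_def by (rule qpoch_nonzero[OF t(1) power_ne_1[OF t(1)]])
  have 1: "O1 * E1 = Q"
    using qpoch_odd_even[OF t(1)] by (simp add: O1_def E1_def Q_def)
  have 2: "Q * B = E1"
    using qpoch_mult_uminus[OF t(1), of t] by (simp add: Q_def B_def E1_def)
  \<comment> \<open>Euler's identity; it makes all base-dependent factors except the cube
    cancel.\<close>
  have OB: "O1 * B = 1"
    using 1 Q0 by (simp flip: 2)
  have 3: "qpoch q t * qpoch (- q) t = O1"
    using qpoch_mult_uminus[OF t(1), of q] by (simp add: O1_def t_def)
  \<comment> \<open>The factor 2 of the formula is the leading factor 1 - (-1) of the product at q /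
    y = -1, for y = -q.\<close>
  have 4: "qpoch (- 1) t = 2 * B"
    using qpoch_head[OF t(1), of "- 1"] by (simp add: B_def)
  have "jtheta q 1 = Q * (qpoch q t * qpoch q t)"
    using jacobi_triple_product[OF q, of 1] by (simp add: Q_def t_def)
  moreover have "jtheta q (- 1) = Q * (qpoch (- q) t * qpoch (- q) t)"
    using jacobi_triple_product[OF q, of "- 1"] by (simp add: Q_def t_def)
  moreover have "jtheta q (- q) = Q * (B * (2 * B))"
    using jacobi_triple_product[OF q, of "- q"] q 4 by (simp add: Q_def B_def t_def power2_eq_square)
  ultimately have "jtheta q 1 * jtheta q (- 1) * jtheta q (- q) =
      2 * Q ^ 3 * ((qpoch q t * qpoch (- q) t) * B) ^ 2"
    by (simp add: power2_eq_square power3_eq_cube mult_ac)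
  thus ?thesis
    unfolding 3 OB by (simp add: Q_def t_def)
qed

text \<open>At y = X / q the triple product contains \<open>qpoch X t\<close>, whose leading factor
  is 1 - X. Each of the three remaining products tends to \<open>qpoch t t\<close>, hence the
  cube.\<close>

lemma jtheta_residue:
  assumes q: "norm q < 1" "q \<noteq> 0"
  shows "((\<lambda>X. jtheta q (X / q) / (1 - X)) \<longlongrightarrow> qpoch (q ^ 2) (q ^ 2) ^ 3) (at 1)"
proof -
  define t where "t = q ^ 2"
  have t: "norm t < 1"
    using q by (auto simp: t_def norm_power power_less_one_iff)
  have c: "((\<lambda>a. qpoch a t) \<longlongrightarrow> qpoch t t) (nhds t)"
    using qpoch_continuous[OF t, of t] tendsto_at_iff_tendsto_nhds[of "\<lambda>a. qpoch a t" t]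
    by (simp add: isCont_def)
  have "((\<lambda>X. X * t) \<longlongrightarrow> 1 * t) (at 1)" "((\<lambda>X. t / X) \<longlongrightarrow> t / 1) (at 1)"
    by (intro tendsto_intros; simp)+
  hence "((\<lambda>X. qpoch (X * t) t) \<longlongrightarrow> qpoch t t) (at 1)" "((\<lambda>X. qpoch (t / X) t) \<longlongrightarrow> qpoch t t) (at 1)"
    by (auto intro: filterlim_compose[OF c])
  hence "((\<lambda>X. qpoch t t * (qpoch (X * t) t * qpoch (t / X) t)) \<longlongrightarrow> qpoch t t * (qpoch t t * qpoch t t)) (at 1)"
    by (intro tendsto_intros)
  moreover have "eventually (\<lambda>X. X \<noteq> 0) (at (1 :: complex))"
    by (intro eventually_neq_at_within)
  hence "eventually (\<lambda>X. qpoch t t * (qpoch (X * t) t * qpoch (t / X) t) = jtheta q (X / q) / (1 - X)) (at 1)"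
    using eventually_neq_at_within[of 1 1 UNIV]
  proof eventually_elim
    case (elim X)
    have "jtheta q (X / q) = qpoch t t * (qpoch X t * qpoch (t / X) t)"
      using jacobi_triple_product[OF q, of "X / q"] elim q by (simp add: t_def power2_eq_square)
    also have "qpoch X t = (1 - X) * qpoch (X * t) t"
      by (rule qpoch_head[OF t])
    finally show ?case
      using elim by (simp add: mult_ac)
  qed
  ultimately have "((\<lambda>X. jtheta q (X / q) / (1 - X)) \<longlongrightarrow> qpoch t t * (qpoch t t * qpoch t t)) (at 1)"
    by (rule Lim_transform_eventually)
  thus ?thesis
    by (simp add: t_def power3_eq_cube mult.assoc)
qed

subsection \<open>The four theta functions\<close>

text \<open>It is applied to points w as well as to the parameter: \<open>nome w ^ 2\<close> is exp
  (2 * \<i> * pi * w), the multiplicative coordinate X of the series.\<close>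

definition nome :: "complex \<Rightarrow> complex" where
  "nome \<tau> = exp (\<i> * of_real pi * \<tau>)"

lemma nome_nonzero [simp]: "nome \<tau> \<noteq> 0"
  by (simp add: nome_def)

lemma norm_nome_less_1:
  assumes "Im \<tau> > 0"
  shows "norm (nome \<tau>) < 1"
  using assms by (simp add: nome_def norm_exp_eq_Re)

lemma qpow_add: "qpow \<tau> (s + t) = qpow \<tau> s * qpow \<tau> t"
  by (simp add: qpow_def exp_add algebra_simps)

lemma qpow_of_nat: "qpow \<tau> (real n) = nome \<tau> ^ n"
  by (simp add: qpow_def nome_def mult.commute flip: exp_of_nat_mult)

lemma jterm_exp: "jterm (exp a) (- exp b) k = exp (of_int k ^ 2 * a + of_int k * b)"
  by (simp add: jterm_def exp_power_int exp_add power2_eq_square)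

lemma jterm_exp': "jterm (exp a) (exp b) k = (-1) powi k * exp (of_int k ^ 2 * a + of_int k * b)"
proof -
  have "(- exp b) powi k = (-1) powi k * exp b powi k"
    using power_int_mult_distrib[of "-1" "exp b" k] by simp
  thus ?thesis
    by (simp add: jterm_def exp_power_int exp_add power2_eq_square mult_ac)
qed

lemma minus_one_powi_uminus: "(- 1 :: complex) powi (- k) = (- 1) powi k"
  by (simp add: power_int_minus flip: power_int_inverse)

lemma theta4_eq_jtheta:
  assumes "Im \<tau> > 0"
  shows "theta4 \<tau> v = jtheta (nome \<tau>) (exp (2 * \<i> * v))"
proof -
  let ?f = "jterm (nome \<tau>) (exp (2 * \<i> * v))"
  have "(\<lambda>n. ?f (int (Suc n)) + ?f (- int (Suc n))) sums (jtheta (nome \<tau>) (exp (2 * \<i> * v)) - ?f 0)"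
    by (intro has_sum_int_imp_sums' jtheta_has_sum norm_nome_less_1 assms)
  moreover have "?f (int (Suc n)) + ?f (- int (Suc n)) =
      2 * ((-1) ^ Suc n * qpow \<tau> ((real (Suc n))\<^sup>2) * cos (2 * of_nat (Suc n) * v))" for n
  proof -
    define m where "m = Suc n"
    have "?f (int m) + ?f (- int m) =
        (-1) ^ m * exp (of_nat m ^ 2 * (\<i> * of_real pi * \<tau>)) *
          (exp (\<i> * (2 * of_nat m * v)) + exp (- (\<i> * (2 * of_nat m * v))))"
      unfolding nome_def jterm_exp' minus_one_powi_uminus power_int_of_nat
      by (simp add: exp_add exp_diff exp_minus field_simps)
    also have "exp (of_nat m ^ 2 * (\<i> * of_real pi * \<tau>)) = qpow \<tau> ((real m)\<^sup>2)"
      by (simp add: qpow_def mult_ac)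
    finally show ?thesis
      unfolding cos_exp_eq m_def by simp
  qed
  moreover have "?f 0 = 1"
    by (simp add: jterm_def)
  ultimately have "(\<lambda>n. 2 * ((-1) ^ Suc n * qpow \<tau> ((real (Suc n))\<^sup>2) * cos (2 * of_nat (Suc n) * v))) sums
      (jtheta (nome \<tau>) (exp (2 * \<i> * v)) - 1)"
    by simp
  from sums_mult[OF this, of "1/2"]
  have "(\<lambda>n. (-1) ^ Suc n * qpow \<tau> ((real (Suc n))\<^sup>2) * cos (2 * of_nat (Suc n) * v)) sums
      ((jtheta (nome \<tau>) (exp (2 * \<i> * v)) - 1) / 2)"
    by simp
  hence "(\<Sum>n. (-1) ^ Suc n * qpow \<tau> ((real (Suc n))\<^sup>2) * cos (2 * of_nat (Suc n) * v)) =
      (jtheta (nome \<tau>) (exp (2 * \<i> * v)) - 1) / 2"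
    by (rule sums_unique[symmetric])
  thus ?thesis
    unfolding theta4_def by (simp only:) (simp add: field_simps)
qed

lemma theta3_eq_jtheta:
  assumes "Im \<tau> > 0"
  shows "theta3 \<tau> v = jtheta (nome \<tau>) (- exp (2 * \<i> * v))"
proof -
  let ?f = "jterm (nome \<tau>) (- exp (2 * \<i> * v))"
  have "(\<lambda>n. ?f (int (Suc n)) + ?f (- int (Suc n))) sums (jtheta (nome \<tau>) (- exp (2 * \<i> * v)) - ?f 0)"
    by (intro has_sum_int_imp_sums' jtheta_has_sum norm_nome_less_1 assms)
  moreover have "?f (int (Suc n)) + ?f (- int (Suc n)) =
      2 * (qpow \<tau> ((real (Suc n))\<^sup>2) * cos (2 * of_nat (Suc n) * v))" for n
  proof -
    define m where "m = Suc n"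
    have "?f (int m) + ?f (- int m) =
        exp (of_nat m ^ 2 * (\<i> * of_real pi * \<tau>)) *
          (exp (\<i> * (2 * of_nat m * v)) + exp (- (\<i> * (2 * of_nat m * v))))"
      unfolding nome_def jterm_exp
      by (simp add: exp_add exp_diff exp_minus field_simps)
    also have "exp (of_nat m ^ 2 * (\<i> * of_real pi * \<tau>)) = qpow \<tau> ((real m)\<^sup>2)"
      by (simp add: qpow_def mult_ac)
    finally show ?thesis
      unfolding cos_exp_eq m_def by simp
  qed
  moreover have "?f 0 = 1"
    by (simp add: jterm_def)
  ultimately have "(\<lambda>n. 2 * (qpow \<tau> ((real (Suc n))\<^sup>2) * cos (2 * of_nat (Suc n) * v))) sums
      (jtheta (nome \<tau>) (- exp (2 * \<i> * v)) - 1)"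
    by simp
  from sums_mult[OF this, of "1/2"]
  have "(\<lambda>n. qpow \<tau> ((real (Suc n))\<^sup>2) * cos (2 * of_nat (Suc n) * v)) sums
      ((jtheta (nome \<tau>) (- exp (2 * \<i> * v)) - 1) / 2)"
    by simp
  hence "(\<Sum>n. qpow \<tau> ((real (Suc n))\<^sup>2) * cos (2 * of_nat (Suc n) * v)) =
      (jtheta (nome \<tau>) (- exp (2 * \<i> * v)) - 1) / 2"
    by (rule sums_unique[symmetric])
  thus ?thesis
    unfolding theta3_def by (simp only:) (simp add: field_simps)
qed

text \<open>Since (n + 1/2)^2 = 1/4 + n^2 + n, the fractional power of the nome is the constant
  \<open>qpow \<tau> (1/4)\<close> and the linear term n is absorbed as a factor of the nome in the
  second argument.\<close>

lemma theta2_eq_jtheta: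
  assumes "Im \<tau> > 0"
  shows "theta2 \<tau> v = qpow \<tau> (1/4) * exp (\<i> * v) * jtheta (nome \<tau>) (- (nome \<tau> * exp (2 * \<i> * v)))"
proof -
  define A where "A = \<i> * of_real pi * \<tau>"
  let ?y = "exp (A + 2 * \<i> * v)"
  let ?f = "jterm (nome \<tau>) (- ?y)"
  have "(\<lambda>n. ?f (int n) + ?f (- int n - 1)) sums jtheta (nome \<tau>) (- ?y)"
    by (intro has_sum_int_imp_sums jtheta_has_sum norm_nome_less_1 assms)
  hence "(\<lambda>n. qpow \<tau> (1/4) * exp (\<i> * v) / 2 * (?f (int n) + ?f (- int n - 1)))
      sums (qpow \<tau> (1/4) * exp (\<i> * v) / 2 * jtheta (nome \<tau>) (- ?y))"
    by (rule sums_mult)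
  moreover have "qpow \<tau> (1/4) * exp (\<i> * v) / 2 * (?f (int n) + ?f (- int n - 1)) =
      qpow \<tau> ((real n + 1/2)\<^sup>2) * cos ((2 * of_nat n + 1) * v)" for n
  proof -
    have "qpow \<tau> ((real n + 1/2)\<^sup>2) = exp (A / 4 + (of_nat n ^ 2 + of_nat n) * A)"
      by (simp add: qpow_def A_def algebra_simps power2_eq_square)
    moreover have "qpow \<tau> (1/4) = exp (A / 4)"
      by (simp add: qpow_def A_def)
    moreover have "?f (int n) = exp ((of_nat n ^ 2 + of_nat n) * A + 2 * of_nat n * (\<i> * v))"
      "?f (- int n - 1) = exp ((of_nat n ^ 2 + of_nat n) * A - (2 * of_nat n + 2) * (\<i> * v))"
      unfolding nome_def A_def [symmetric] jterm_exp by (simp_all add: algebra_simps power2_eq_square)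
    ultimately show ?thesis
      unfolding cos_exp_eq
      by (simp add: field_simps flip: exp_add)
  qed
  ultimately have "(\<lambda>n. qpow \<tau> ((real n + 1/2)\<^sup>2) * cos ((2 * of_nat n + 1) * v))
      sums (qpow \<tau> (1/4) * exp (\<i> * v) / 2 * jtheta (nome \<tau>) (- ?y))"
    by simp
  from sums_unique[OF this] have "theta2 \<tau> v = qpow \<tau> (1/4) * exp (\<i> * v) * jtheta (nome \<tau>) (- ?y)"
    unfolding theta2_def by simp
  also have "?y = nome \<tau> * exp (2 * \<i> * v)"
    by (simp add: nome_def A_def exp_add)
  finally show ?thesis .
qed

lemma theta1_eq_jtheta:
  assumes "Im \<tau> > 0"
  shows "theta1 \<tau> v = - \<i> * qpow \<tau> (1/4) * exp (\<i> * v) * jtheta (nome \<tau>) (nome \<tau> * exp (2 * \<i> * v))"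
proof -
  define A where "A = \<i> * of_real pi * \<tau>"
  let ?y = "exp (A + 2 * \<i> * v)"
  let ?f = "jterm (nome \<tau>) ?y"
  have "(\<lambda>n. ?f (int n) + ?f (- int n - 1)) sums jtheta (nome \<tau>) ?y"
    by (intro has_sum_int_imp_sums jtheta_has_sum norm_nome_less_1 assms)
  hence "(\<lambda>n. - \<i> * qpow \<tau> (1/4) * exp (\<i> * v) / 2 * (?f (int n) + ?f (- int n - 1)))
      sums (- \<i> * qpow \<tau> (1/4) * exp (\<i> * v) / 2 * jtheta (nome \<tau>) ?y)"
    by (rule sums_mult)
  moreover have "- \<i> * qpow \<tau> (1/4) * exp (\<i> * v) / 2 * (?f (int n) + ?f (- int n - 1)) =
      (-1) ^ n * qpow \<tau> ((real n + 1/2)\<^sup>2) * sin ((2 * of_nat n + 1) * v)" for n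
  proof -
    \<comment> \<open>The opposite signs at n and -n - 1 turn the pair into a difference of
      exponentials, hence a sine in place of a cosine.\<close>
    have s: "(- 1 :: complex) powi (- int n - 1) = - ((- 1) ^ n)"
    proof -
      have "- int n - 1 = - int (Suc n)" by simp
      thus ?thesis
        by (simp only: minus_one_powi_uminus power_int_of_nat) simp
    qed
    have "qpow \<tau> ((real n + 1/2)\<^sup>2) = exp (A / 4 + (of_nat n ^ 2 + of_nat n) * A)"
      by (simp add: qpow_def A_def algebra_simps power2_eq_square)
    moreover have "qpow \<tau> (1/4) = exp (A / 4)"
      by (simp add: qpow_def A_def)
    moreover have "?f (int n) = (-1) ^ n * exp ((of_nat n ^ 2 + of_nat n) * A + 2 * of_nat n * (\<i> * v))"
      "?f (- int n - 1) = - ((-1) ^ n * exp ((of_nat n ^ 2 + of_nat n) * A - (2 * of_nat n + 2) * (\<i> * v)))"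
      unfolding nome_def A_def [symmetric] jterm_exp' s by (simp_all add: algebra_simps power2_eq_square)
    ultimately show ?thesis
      unfolding sin_exp_eq
      by (simp add: field_simps flip: exp_add)
  qed
  ultimately have "(\<lambda>n. (-1) ^ n * qpow \<tau> ((real n + 1/2)\<^sup>2) * sin ((2 * of_nat n + 1) * v))
      sums (- \<i> * qpow \<tau> (1/4) * exp (\<i> * v) / 2 * jtheta (nome \<tau>) ?y)"
    by simp
  from sums_unique[OF this, symmetric]
  have "theta1 \<tau> v = - \<i> * qpow \<tau> (1/4) * exp (\<i> * v) * jtheta (nome \<tau>) ?y"
    unfolding theta1_def by (simp only:) simp
  also have "?y = nome \<tau> * exp (2 * \<i> * v)"
    by (simp add: nome_def A_def exp_add)
  finally show ?thesis .
qed

text \<open>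
  The function \<open>SN\<close> in the variable \<open>w = z - 1 + \<tau> / 2\<close>, which moves a pole to \<open>0\<close>.
\<close>

definition sn_theta :: "complex \<Rightarrow> complex \<Rightarrow> complex" where
  "sn_theta \<tau> w = \<i> / 4 * exp (\<i> * of_real pi * w) * jtheta (nome \<tau>) (- nome \<tau>) * jtheta (nome \<tau>) (- 1) *
     jtheta (nome \<tau>) (nome w ^ 2) / jtheta (nome \<tau>) (nome w ^ 2 / nome \<tau>)"

lemma SN_eq_sn_theta:
  assumes "Im \<tau> > 0"
  shows "SN z \<tau> = sn_theta \<tau> (z - 1 + \<tau> / 2)"
proof -
  define w where "w = z - 1 + \<tau> / 2"
  define q where "q = nome \<tau>"
  define q4 where "q4 = qpow \<tau> (1/4)"
  have q: "norm q < 1" "q \<noteq> 0"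
    using norm_nome_less_1[OF assms] by (auto simp: q_def)
  \<comment> \<open>The shift by -1 contributes exp (-2 * pi * \<i>) = 1 and the shift by \<tau> / 2
    contributes q. Thus the arguments of \<open>theta1\<close> and \<open>theta4\<close> become X
    and X / q.\<close>
  have y: "q * exp (2 * \<i> * (of_real pi * z)) = nome w ^ 2"
  proof -
    have "nome w ^ 2 = exp (2 * \<i> * (of_real pi * z) + \<i> * of_real pi * \<tau> - 2 * of_real pi * \<i>)"
      by (simp add: nome_def w_def algebra_simps flip: exp_double)
    also have "\<dots> = exp (2 * \<i> * (of_real pi * z)) * q"
      by (simp add: exp_diff exp_add q_def nome_def)
    finally show ?thesis by simp
  qed
  have th3: "theta3 \<tau> 0 = jtheta q (- 1)"
    using theta3_eq_jtheta[OF assms, of 0] by (simp add: q_def)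
  \<comment> \<open>Needed to recover z from 2 * K * z in \<open>jacobi_sn\<close>, and to cancel
    \<open>theta3\<close> in K * k / (2 * pi) = \<open>theta2\<close>^2 / 4.\<close>
  have "theta3 \<tau> 0 \<noteq> 0"
  proof -
    have "norm (- q * (q ^ 2) ^ n) < 1" for n
    proof -
      have "norm (- q * (q ^ 2) ^ n) = norm q ^ Suc (2 * n)"
        by (simp add: norm_mult norm_power flip: power_mult)
      thus ?thesis
        using q power_Suc_less_one[of "norm q" "2 * n"] by simp
    qed
    hence "- q * (q ^ 2) ^ n \<noteq> 1" for n
      by (metis less_irrefl norm_one)
    thus ?thesis
      unfolding th3 by (intro jtheta_nonzero q) auto
  qed
  hence K: "jacobi_K \<tau> \<noteq> 0"
    by (simp add: jacobi_K_def)
  have "SN z \<tau> = theta2 \<tau> 0 * theta3 \<tau> 0 * theta1 \<tau> (of_real pi * z) / (4 * theta4 \<tau> (of_real pi * z))"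
    using K \<open>theta3 \<tau> 0 \<noteq> 0\<close>
    by (simp add: SN_def jacobi_sn_def jacobi_k_def jacobi_K_def power2_eq_square)
  also have "theta2 \<tau> 0 = q4 * jtheta q (- q)"
    using theta2_eq_jtheta[OF assms, of 0] by (simp add: q_def q4_def)
  also have "theta4 \<tau> (of_real pi * z) = jtheta q (nome w ^ 2 / q)"
  proof -
    have "exp (2 * \<i> * (of_real pi * z)) = nome w ^ 2 / q"
      using q by (simp flip: y)
    thus ?thesis
      using theta4_eq_jtheta[OF assms] by (simp add: q_def)
  qed
  \<comment> \<open>Passing from z to w trades \<open>q4\<close> for its inverse, which cancels
    against the \<open>q4\<close> of \<open>theta2\<close>; no fractional power of the nome survives
    in \<open>sn_theta\<close>.\<close>
  also have "theta1 \<tau> (of_real pi * z) = \<i> / q4 * exp (\<i> * of_real pi * w) * jtheta q (nome w ^ 2)"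
  proof -
    note y
    moreover have "- \<i> * q4 * exp (\<i> * (of_real pi * z)) = \<i> / q4 * exp (\<i> * of_real pi * w)"
    proof -
      have "exp (\<i> * of_real pi * w) = exp (\<i> * (of_real pi * z) + \<i> * of_real pi * \<tau> / 2 - of_real pi * \<i>)"
        by (simp add: w_def algebra_simps)
      also have "\<dots> = - exp (\<i> * (of_real pi * z)) * exp (\<i> * of_real pi * \<tau> / 2)"
        by (simp add: exp_diff exp_add)
      also have "exp (\<i> * of_real pi * \<tau> / 2) = q4 * q4"
        by (simp add: q4_def qpow_def mult_ac flip: exp_add)
      finally show ?thesis
        by (simp add: q4_def qpow_def)
    qed
    ultimately show ?thesis
      using theta1_eq_jtheta[OF assms, of "of_real pi * z"] by (simp add: q_def q4_def)
  qed
  also note th3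
  finally show ?thesis
    by (simp add: sn_theta_def w_def q_def q4_def qpow_def)
qed

subsection \<open>Three representations of the same elliptic function\<close>

lemma nome_add: "nome (a + b) = nome a * nome b"
  and nome_diff: "nome (a - b) = nome a / nome b"
  and nome_uminus: "nome (- a) = 1 / nome a"
  and nome_1: "nome 1 = - 1"
  by (simp_all add: nome_def ring_distribs exp_add exp_diff exp_minus divide_inverse mult_ac)

lemma norm_nome: "norm (nome w) = exp (- pi * Im w)"
  by (simp add: nome_def norm_exp_eq_Re)

lemma lat_im_mult: "Im \<tau> > 0 \<Longrightarrow> lat_im \<tau> w * Im \<tau> = Im w"
  by (simp add: lat_im_def)

text \<open>As the norm of \<open>nome w ^ 2\<close> is exp (-2 * pi * Im w), strips in
  \<open>lat_im\<close> are annuli in X: |\<open>lat_im\<close>| < 1 is the domain of the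
  continuation, and its upper half 0 < \<open>lat_im\<close> < 1 that of the bilateral
  series.\<close>

lemma norm_nome_sq_bounds:
  assumes \<tau>: "Im \<tau> > 0"
  shows "- 1 < lat_im \<tau> w \<Longrightarrow> norm (nome \<tau> ^ 2) * norm (nome w ^ 2) < 1"
    and "lat_im \<tau> w < 1 \<Longrightarrow> norm (nome \<tau> ^ 2) < norm (nome w ^ 2)"
    and "lat_im \<tau> w < 0 \<Longrightarrow> 1 < norm (nome w ^ 2)"
    and "0 < lat_im \<tau> w \<Longrightarrow> norm (nome w ^ 2) < 1"
proof -
  have n: "norm (nome u ^ 2) = exp (- 2 * pi * Im u)" for u
    by (simp add: norm_power norm_nome flip: exp_double)
  note im = lat_im_mult[OF \<tau>, of w, symmetric]
  show "norm (nome \<tau> ^ 2) * norm (nome w ^ 2) < 1" if "- 1 < lat_im \<tau> w"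
  proof -
    have "0 < pi * ((1 + lat_im \<tau> w) * Im \<tau>)"
      using that \<tau> by simp
    thus ?thesis
      unfolding n im by (simp add: algebra_simps flip: exp_add)
  qed
  show "norm (nome \<tau> ^ 2) < norm (nome w ^ 2)" if "lat_im \<tau> w < 1"
    unfolding n im using that \<tau> by simp
  show "1 < norm (nome w ^ 2)" if "lat_im \<tau> w < 0"
    unfolding n im using that \<tau> by (simp add: mult_neg_pos mult_pos_neg)
  show "norm (nome w ^ 2) < 1" if "0 < lat_im \<tau> w"
    unfolding n im using that \<tau> by simp
qed

lemma nome_sq_ne_1:
  assumes \<tau>: "Im \<tau> > 0" and w: "w \<in> cell \<tau> - {0}"
  shows "nome w ^ 2 \<noteq> 1"
proof
  assume "nome w ^ 2 = 1"
  hence "exp (2 * \<i> * of_real pi * w) = 1"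
    by (simp add: nome_def mult_ac flip: exp_double)
  then obtain n :: int where n: "Im w = 0" "Re w = of_int n"
    by (auto simp: exp_eq_1)
  hence "\<bar>of_int n :: real\<bar> < 1"
    using w by (simp add: cell_def lat_re_def)
  hence "n = 0" by linarith
  with n w show False by (simp add: complex_eq_iff)
qed

text \<open>The derivative of exp (2 * \<i> * pi * w) at 0 is 2 * \<i> * pi, and i / (2 * pi) is
  minus its reciprocal. The second limit stays off the point 1, so that limits at the pole X = 1 can
  be composed with it.\<close>

lemma nome_sq_pole:
  "((\<lambda>w. w / (1 - nome w ^ 2)) \<longlongrightarrow> \<i> / (2 * of_real pi)) (at 0)"
  "filterlim (\<lambda>w. nome w ^ 2) (at 1) (at 0)"
proof -
  define c where "c = 2 * \<i> * complex_of_real pi"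
  have c: "c \<noteq> 0" by (simp add: c_def)
  have n: "nome w ^ 2 = exp (c * w)" for w
    by (simp add: nome_def c_def mult_ac flip: exp_double)
  have "((\<lambda>w. exp (c * w)) has_field_derivative c) (at 0)"
    by (auto intro!: derivative_eq_intros)
  hence d: "((\<lambda>w. (exp (c * w) - 1) / w) \<longlongrightarrow> c) (at 0)"
    by (simp add: DERIV_def)
  hence "((\<lambda>w. - (1 / ((exp (c * w) - 1) / w))) \<longlongrightarrow> - (1 / c)) (at 0)"
    using c by (intro tendsto_intros)
  moreover have "- (1 / ((exp (c * w) - 1) / w)) = w / (1 - nome w ^ 2)" for w
    by (metis (no_types) divide_divide_eq_right minus_diff_eq minus_divide_right mult_1 n)
  moreover have "- (1 / c) = \<i> / (2 * of_real pi)"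
    by (simp add: c_def field_simps)
  ultimately show "((\<lambda>w. w / (1 - nome w ^ 2)) \<longlongrightarrow> \<i> / (2 * of_real pi)) (at 0)"
    by simp
  have "eventually (\<lambda>w. (exp (c * w) - 1) / w \<noteq> 0) (at 0)"
    using d c by (rule tendsto_imp_eventually_ne)
  hence "eventually (\<lambda>w. nome w ^ 2 \<noteq> 1) (at 0)"
    by eventually_elim (auto simp: n)
  moreover have "((\<lambda>w. nome w ^ 2) \<longlongrightarrow> nome 0 ^ 2) (at 0)"
    unfolding nome_def by (intro tendsto_intros)
  ultimately show "filterlim (\<lambda>w. nome w ^ 2) (at 1) (at 0)"
    by (simp add: filterlim_at nome_def)
qed

lemma nome_holomorphic [holomorphic_intros]:
  "f holomorphic_on A \<Longrightarrow> (\<lambda>w. nome (f w)) holomorphic_on A"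
  unfolding nome_def by (intro holomorphic_intros)

text \<open>
  The translation rules are required only where both arguments lie in the doubled cell, because
  the functions built from \<open>kronecker\<close> are meaningful only on a strip.
\<close>

definition quasi_elliptic :: "complex \<Rightarrow> complex \<Rightarrow> (complex \<Rightarrow> complex) \<Rightarrow> bool" where
  "quasi_elliptic \<tau> c f \<longleftrightarrow> f holomorphic_on cell \<tau> - {0} \<and> ((\<lambda>w. w * f w) \<longlongrightarrow> c) (at 0) \<and>
    (\<forall>w. 0 < lat_re \<tau> w \<and> lat_re \<tau> w < 1 \<and> \<bar>lat_im \<tau> w\<bar> < 1 \<longrightarrow> f (w - 1) = - f w) \<and>
    (\<forall>w. \<bar>lat_re \<tau> w\<bar> < 1 \<and> 0 < lat_im \<tau> w \<and> lat_im \<tau> w < 1 \<longrightarrow> f (w - \<tau>) = f w)"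

lemma quasi_elliptic_unique:
  assumes \<tau>: "Im \<tau> > 0" and f: "quasi_elliptic \<tau> c f" and g: "quasi_elliptic \<tau> c g"
    and w: "w \<in> cell \<tau> - {0}"
  shows "f w = g w"
proof -
  have "f w - g w = 0"
  proof (rule elliptic_unique[OF \<tau> _ _ _ _ w])
    show "(\<lambda>w. f w - g w) holomorphic_on cell \<tau> - {0}"
      using f g by (auto simp: quasi_elliptic_def intro!: holomorphic_intros)
    have "((\<lambda>w. w * f w - w * g w) \<longlongrightarrow> c - c) (at 0)"
      using f g unfolding quasi_elliptic_def by (intro tendsto_diff) auto
    thus "((\<lambda>w. w * (f w - g w)) \<longlongrightarrow> 0) (at 0)"
      by (simp add: algebra_simps)
    fix a b :: real
    have 1: "of_real (a - 1) + of_real b * \<tau> = (of_real a + of_real b * \<tau>) - 1"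
      and 2: "of_real a + of_real (b - 1) * \<tau> = (of_real a + of_real b * \<tau>) - \<tau>"
      by (simp_all add: algebra_simps)
    show "f (of_real (a - 1) + of_real b * \<tau>) - g (of_real (a - 1) + of_real b * \<tau>) =
        - (f (of_real a + of_real b * \<tau>) - g (of_real a + of_real b * \<tau>))"
      if "0 < a" "a < 1" "\<bar>b\<bar> < 1"
      unfolding 1 using f g that \<tau> by (simp add: quasi_elliptic_def)
    show "f (of_real a + of_real (b - 1) * \<tau>) - g (of_real a + of_real (b - 1) * \<tau>) =
        f (of_real a + of_real b * \<tau>) - g (of_real a + of_real b * \<tau>)"
      if "\<bar>a\<bar> < 1" "0 < b" "b < 1"
      unfolding 2 using f g that \<tau> by (simp add: quasi_elliptic_def)
  qed
  thus ?thesis by simp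
qed

text \<open>Under w - 1 only the exponential prefactor changes. Under w + \<tau> the numerator gains
  -1 / (q * X) and the denominator -1 / X; their quotient 1 / q is undone by the factor q of the
  prefactor.\<close>

lemma sn_theta_shift:
  assumes \<tau>: "Im \<tau> > 0"
  shows "sn_theta \<tau> (w - 1) = - sn_theta \<tau> w"
    and "sn_theta \<tau> (w - \<tau>) = sn_theta \<tau> w"
proof -
  show "sn_theta \<tau> (w - 1) = - sn_theta \<tau> w"
    by (simp add: sn_theta_def nome_diff nome_1 algebra_simps exp_diff)
  have *: "sn_theta \<tau> (u + \<tau>) = sn_theta \<tau> u" for u
  proof -
    define q X where "q = nome \<tau>" and "X = nome u ^ 2"
    have q: "norm q < 1" "q \<noteq> 0" and X: "X \<noteq> 0"
      using norm_nome_less_1[OF \<tau>] by (auto simp: q_def X_def)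
    have 1: "nome (u + \<tau>) ^ 2 = q ^ 2 * X" and 2: "nome (u + \<tau>) ^ 2 / nome \<tau> = q ^ 2 * (X / q)"
      by (simp_all add: nome_add q_def X_def power_mult_distrib)
    have "exp (\<i> * of_real pi * (u + \<tau>)) = q * exp (\<i> * of_real pi * u)"
      by (simp add: q_def nome_def ring_distribs exp_add)
    moreover have "jtheta q (q ^ 2 * X) = - jtheta q X / (q * X)"
      "jtheta q (q ^ 2 * (X / q)) = - jtheta q (X / q) / X"
      using jtheta_shift[OF q, of X] jtheta_shift[OF q, of "X / q"] q X by simp_all
    ultimately show ?thesis
      using q X unfolding sn_theta_def 1 2 q_def[symmetric] X_def[symmetric] by simp
  qed
  show "sn_theta \<tau> (w - \<tau>) = sn_theta \<tau> w"
    using *[of "w - \<tau>"] by simp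
qed

lemma quasi_elliptic_sn_theta:
  assumes \<tau>: "Im \<tau> > 0"
  shows "quasi_elliptic \<tau> (- 1 / (4 * of_real pi)) (sn_theta \<tau>)"
proof -
  define q where "q = nome \<tau>"
  have q: "norm q < 1" "q \<noteq> 0"
    using norm_nome_less_1[OF \<tau>] by (auto simp: q_def)
  have t: "norm (q ^ 2) < 1"
    using q by (auto simp: norm_power power_less_one_iff)
  define c where "c = \<i> / 4 * jtheta q (- q) * jtheta q (- 1)"
  have sn: "sn_theta \<tau> w = c * exp (\<i> * of_real pi * w) * jtheta q (nome w ^ 2) / jtheta q (nome w ^ 2 / q)" for w
    by (simp add: sn_theta_def q_def c_def)
  \<comment> \<open>By the triple product the zeros are at the even powers of q. The annulus leaves
    only X = 1, which in the cell occurs at the removed point 0.\<close>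
  have nz: "jtheta q (nome w ^ 2 / q) \<noteq> 0" if "w \<in> cell \<tau> - {0}" for w
  proof -
    define X where "X = nome w ^ 2"
    have b: "norm (q ^ 2) * norm X < 1" "norm (q ^ 2) < norm X" "X \<noteq> 1"
      using norm_nome_sq_bounds(1,2)[OF \<tau>, of w] nome_sq_ne_1[OF \<tau> that] that
      by (auto simp: cell_def q_def X_def)
    have X0: "X \<noteq> 0" by (simp add: X_def)
    show ?thesis unfolding X_def[symmetric]
    proof (rule jtheta_nonzero[OF q])
      show "X / q \<noteq> 0" using X0 q by simp
      fix n
      have le: "norm (q ^ 2) ^ m \<le> 1" for m
        using t by (intro power_le_one) auto
      have "X * (q ^ 2) ^ n \<noteq> 1"
      proof (cases n)
        case (Suc m)
        have "norm (X * (q ^ 2) ^ n) = (norm (q ^ 2) * norm X) * norm (q ^ 2) ^ m"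
          by (simp add: Suc norm_mult norm_power)
        also have "\<dots> \<le> (norm (q ^ 2) * norm X) * 1"
          by (intro mult_left_mono le mult_nonneg_nonneg norm_ge_zero)
        finally show ?thesis using b by (metis mult_1_right norm_one not_less)
      qed (use b in simp)
      thus "X / q * q * (q ^ 2) ^ n \<noteq> 1" using q by simp
      have "norm (q ^ 2 / X * (q ^ 2) ^ n) = norm (q ^ 2) / norm X * norm (q ^ 2) ^ n"
        by (simp add: norm_mult norm_power norm_divide)
      also have "\<dots> \<le> norm (q ^ 2) / norm X * 1"
        by (intro mult_left_mono le) simp
      also have "\<dots> < 1" using b X0 by (simp add: divide_simps)
      finally have "q ^ 2 / X * (q ^ 2) ^ n \<noteq> 1"
        by (metis norm_one less_irrefl)
      thus "q / (X / q) * (q ^ 2) ^ n \<noteq> 1"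
        by (simp add: power2_eq_square)
    qed
  qed
  have hol: "sn_theta \<tau> holomorphic_on cell \<tau> - {0}"
  proof -
    have "jtheta q \<circ> (\<lambda>w. nome w ^ 2) holomorphic_on cell \<tau> - {0}"
      by (rule holomorphic_on_compose_gen[OF _ jtheta_holomorphic[OF q(1)]])
         (auto intro!: holomorphic_intros)
    moreover have "jtheta q \<circ> (\<lambda>w. nome w ^ 2 / q) holomorphic_on cell \<tau> - {0}"
      by (rule holomorphic_on_compose_gen[OF _ jtheta_holomorphic[OF q(1)]])
         (use q in \<open>auto intro!: holomorphic_intros\<close>)
    ultimately show ?thesis
      unfolding sn o_def using nz by (intro holomorphic_intros) auto
  qed
  have lim: "((\<lambda>w. w * sn_theta \<tau> w) \<longlongrightarrow> - 1 / (4 * of_real pi)) (at 0)"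
  proof -
    define Q where "Q = qpoch (q ^ 2) (q ^ 2)"
    have Q: "Q \<noteq> 0"
      unfolding Q_def by (rule qpoch_nonzero[OF t power_ne_1[OF t]])
    have "continuous_on (- {0}) (jtheta q)"
      by (intro holomorphic_on_imp_continuous_on jtheta_holomorphic q)
    hence "isCont (jtheta q) 1"
      by (simp add: continuous_on_eq_continuous_at open_Compl)
    hence "(jtheta q \<longlongrightarrow> jtheta q 1) (at 1)"
      by (simp add: isCont_def)
    hence 1: "((\<lambda>w. jtheta q (nome w ^ 2)) \<longlongrightarrow> jtheta q 1) (at 0)"
      by (rule filterlim_compose[OF _ nome_sq_pole(2)])
    have 2: "((\<lambda>w. jtheta q (nome w ^ 2 / q) / (1 - nome w ^ 2)) \<longlongrightarrow> Q ^ 3) (at 0)"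
      unfolding Q_def by (rule filterlim_compose[OF jtheta_residue[OF q] nome_sq_pole(2)])
    have 3: "((\<lambda>w. exp (\<i> * of_real pi * w)) \<longlongrightarrow> exp (\<i> * of_real pi * 0)) (at 0)"
      by (intro tendsto_intros)
    have "((\<lambda>w. c * exp (\<i> * of_real pi * w) * jtheta q (nome w ^ 2) * (w / (1 - nome w ^ 2)) /
        (jtheta q (nome w ^ 2 / q) / (1 - nome w ^ 2))) \<longlongrightarrow>
        c * exp (\<i> * of_real pi * 0) * jtheta q 1 * (\<i> / (2 * of_real pi)) / Q ^ 3) (at 0)"
      using Q by (intro tendsto_mult tendsto_divide tendsto_const 1 2 3 nome_sq_pole(1)) simp
    \<comment> \<open>The constants i / 4 and i / (2 * pi) give -1 / (8 * pi); the derivative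
      identity replaces the three theta values by 2 * Q ^ 3.\<close>
    also have "c * exp (\<i> * of_real pi * 0) * jtheta q 1 * (\<i> / (2 * of_real pi)) / Q ^ 3 =
        - (jtheta q 1 * jtheta q (- 1) * jtheta q (- q)) / (8 * of_real pi * Q ^ 3)"
      by (simp add: c_def field_simps)
    also have "\<dots> = - 1 / (4 * of_real pi)"
      unfolding jtheta_derivative_formula[OF q] using Q by (simp add: Q_def)
    finally show ?thesis
    proof (rule Lim_transform_eventually)
      have "eventually (\<lambda>w. nome w ^ 2 \<noteq> 1) (at 0)"
        using nome_sq_pole(2) by (simp add: filterlim_at)
      thus "eventually (\<lambda>w. c * exp (\<i> * of_real pi * w) * jtheta q (nome w ^ 2) * (w / (1 - nome w ^ 2)) /
        (jtheta q (nome w ^ 2 / q) / (1 - nome w ^ 2)) = w * sn_theta \<tau> w) (at 0)"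
        by eventually_elim (simp add: sn)
    qed
  qed
  show ?thesis
    unfolding quasi_elliptic_def using hol lim sn_theta_shift[OF \<tau>] by auto
qed

section \<open>The Kronecker function on the doubled cell\<close>

lemma kronecker_nome_holomorphic:
  assumes \<tau>: "Im \<tau> > 0" and W: "W \<noteq> 0"
  shows "(\<lambda>v. kronecker (nome \<tau> ^ 2) W (nome v ^ 2)) holomorphic_on cell \<tau> - {0}"
proof -
  have "kronecker (nome \<tau> ^ 2) W \<circ> (\<lambda>v. nome v ^ 2) holomorphic_on cell \<tau> - {0}"
  proof (rule holomorphic_on_compose)
    show "kronecker (nome \<tau> ^ 2) W holomorphic_on (\<lambda>v. nome v ^ 2) ` (cell \<tau> - {0})"
    proof (rule kronecker_holomorphic[OF _ W])
      show "norm (nome \<tau> ^ 2) < 1"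
        using norm_nome_less_1[OF \<tau>] by (simp add: norm_power power_less_one_iff)
      fix X assume "X \<in> (\<lambda>v. nome v ^ 2) ` (cell \<tau> - {0})"
      then obtain v where v: "v \<in> cell \<tau> - {0}" and X: "X = nome v ^ 2"
        by blast
      show "norm (nome \<tau> ^ 2) < norm X \<and> norm (nome \<tau> ^ 2) * norm X < 1 \<and> X \<noteq> 1"
        using norm_nome_sq_bounds(1,2)[OF \<tau>, of v] nome_sq_ne_1[OF \<tau> v] v
        by (auto simp: cell_def X)
    qed
  qed (intro holomorphic_intros)
  thus ?thesis by (simp add: o_def)
qed

lemma kronecker_nome_residue:
  assumes \<tau>: "Im \<tau> > 0" and W: "W \<noteq> 0"
  shows "((\<lambda>v. v * kronecker (nome \<tau> ^ 2) W (nome v ^ 2)) \<longlongrightarrow> \<i> / (2 * of_real pi)) (at 0)"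
proof -
  have P: "norm (nome \<tau> ^ 2) < 1"
    using norm_nome_less_1[OF \<tau>] by (simp add: norm_power power_less_one_iff)
  have "((\<lambda>v. v / (1 - nome v ^ 2) * ((1 - nome v ^ 2) * kronecker (nome \<tau> ^ 2) W (nome v ^ 2)))
      \<longlongrightarrow> \<i> / (2 * of_real pi) * 1) (at 0)"
    by (intro tendsto_mult nome_sq_pole(1) filterlim_compose[OF kronecker_residue[OF P W] nome_sq_pole(2)])
  hence "((\<lambda>v. v / (1 - nome v ^ 2) * ((1 - nome v ^ 2) * kronecker (nome \<tau> ^ 2) W (nome v ^ 2)))
      \<longlongrightarrow> \<i> / (2 * of_real pi)) (at 0)"
    by simp
  thus ?thesis
  proof (rule Lim_transform_eventually)
    have "eventually (\<lambda>v. nome v ^ 2 \<noteq> 1) (at 0)"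
      using nome_sq_pole(2) by (simp add: filterlim_at)
    thus "eventually (\<lambda>v. v / (1 - nome v ^ 2) * ((1 - nome v ^ 2) * kronecker (nome \<tau> ^ 2) W (nome v ^ 2)) =
        v * kronecker (nome \<tau> ^ 2) W (nome v ^ 2)) (at 0)"
      by eventually_elim simp
  qed
qed

lemma kronecker_nome_shift:
  assumes \<tau>: "Im \<tau> > 0" and v: "- 1 < lat_im \<tau> v" "lat_im \<tau> v < 0"
    and W: "\<And>n. (nome \<tau> ^ 2) ^ n * W \<noteq> 1" "\<And>n. (nome \<tau> ^ 2) ^ Suc n \<noteq> W" "W \<noteq> 0"
  shows "kronecker (nome \<tau> ^ 2) W (nome (v + \<tau>) ^ 2) = kronecker (nome \<tau> ^ 2) W (nome v ^ 2) / W"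
proof -
  have "nome (v + \<tau>) ^ 2 = nome \<tau> ^ 2 * nome v ^ 2"
    by (simp add: nome_add power_mult_distrib)
  thus ?thesis
    using kronecker_shift[OF _ _ W, of "nome v ^ 2"] norm_nome_sq_bounds(1,3)[OF \<tau>, of v] v
      norm_nome_less_1[OF \<tau>]
    by (simp add: norm_power power_less_one_iff)
qed

lemma power_nome_ne:
  assumes \<tau>: "Im \<tau> > 0" and "norm c = 1" "n > 0"
  shows "nome \<tau> ^ n \<noteq> c"
proof -
  have "norm (nome \<tau> ^ n) < 1"
    using norm_nome_less_1[OF \<tau>] assms(3) by (simp add: norm_power power_less_one_iff)
  thus ?thesis using assms(2) by auto
qed

text \<open>The nonvanishing conditions of the Kronecker function for its two weights q and -1: in
  each pair the first concerns W and the second P / W.\<close>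

lemma nome_weights:
  assumes \<tau>: "Im \<tau> > 0"
  shows "(nome \<tau> ^ 2) ^ n * nome \<tau> \<noteq> 1" "(nome \<tau> ^ 2) ^ Suc n \<noteq> nome \<tau>"
    and "(nome \<tau> ^ 2) ^ n * (- 1) \<noteq> 1" "(nome \<tau> ^ 2) ^ Suc n \<noteq> - 1"
proof -
  have e: "(nome \<tau> ^ 2) ^ m = nome \<tau> ^ (2 * m)" for m
    by (rule power_mult[symmetric])
  have 1: "nome \<tau> ^ Suc (2 * n) \<noteq> 1"
    by (rule power_nome_ne[OF \<tau>]) simp_all
  show "(nome \<tau> ^ 2) ^ n * nome \<tau> \<noteq> 1"
    using 1 unfolding e power_Suc2 .
  show "(nome \<tau> ^ 2) ^ Suc n \<noteq> nome \<tau>"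
  proof
    assume "(nome \<tau> ^ 2) ^ Suc n = nome \<tau>"
    moreover have "2 * Suc n = Suc (Suc (2 * n))" by simp
    ultimately have "nome \<tau> * nome \<tau> ^ Suc (2 * n) = nome \<tau> * 1"
      unfolding e by (simp only: power_Suc mult_1_right)
    with 1 show False
      unfolding mult_cancel_left by simp
  qed
  show 2: "(nome \<tau> ^ 2) ^ Suc m \<noteq> - 1" for m
    unfolding e by (rule power_nome_ne[OF \<tau>]) simp_all
  show "(nome \<tau> ^ 2) ^ n * (- 1) \<noteq> 1"
  proof
    assume "(nome \<tau> ^ 2) ^ n * (- 1) = 1"
    from arg_cong[OF this, of uminus] have *: "(nome \<tau> ^ 2) ^ n = - 1"
      by simp
    show False
    proof (cases n)
      case (Suc m)
      with * 2[of m] show ?thesis by blast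
    qed (use * in simp)
  qed
qed

text \<open>
  In the strip \<open>0 < lat_im \<tau> w < 1\<close> this is the sine series of the theorem.
\<close>

definition sn_q :: "complex \<Rightarrow> complex \<Rightarrow> complex" where
  "sn_q \<tau> w = \<i> / 2 * nome w * kronecker (nome \<tau> ^ 2) (nome \<tau>) (nome w ^ 2)"

lemma sn_q_minus_one: "sn_q \<tau> (w - 1) = - sn_q \<tau> w"
  by (simp add: sn_q_def nome_diff nome_1)

text \<open>The prefactor \<open>nome w\<close> compensates the multiplier 1 / q under \<tau> and
  alone produces the sign under 1. The residue is i / 2 times i / (2 * pi).\<close>

lemma quasi_elliptic_sn_q:
  assumes \<tau>: "Im \<tau> > 0"
  shows "quasi_elliptic \<tau> (- 1 / (4 * of_real pi)) (sn_q \<tau>)"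
proof -
  have hol: "sn_q \<tau> holomorphic_on cell \<tau> - {0}"
    unfolding sn_q_def by (intro holomorphic_intros kronecker_nome_holomorphic \<tau>) auto
  have "((\<lambda>w. \<i> / 2 * nome w * (w * kronecker (nome \<tau> ^ 2) (nome \<tau>) (nome w ^ 2))) \<longlongrightarrow>
      \<i> / 2 * nome 0 * (\<i> / (2 * of_real pi))) (at 0)"
    by (intro tendsto_mult tendsto_const kronecker_nome_residue \<tau> nome_nonzero)
       (auto simp: nome_def intro!: tendsto_eq_intros)
  hence lim: "((\<lambda>w. w * sn_q \<tau> w) \<longlongrightarrow> - 1 / (4 * of_real pi)) (at 0)"
    by (simp add: sn_q_def nome_def mult_ac)
  have per: "sn_q \<tau> (w - \<tau>) = sn_q \<tau> w" if "0 < lat_im \<tau> w" "lat_im \<tau> w < 1" for w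
  proof -
    have "lat_im \<tau> (w - \<tau>) = lat_im \<tau> w - 1"
      using \<tau> by (simp add: lat_im_def diff_divide_distrib)
    hence "kronecker (nome \<tau> ^ 2) (nome \<tau>) (nome w ^ 2) = kronecker (nome \<tau> ^ 2) (nome \<tau>) (nome (w - \<tau>) ^ 2) / nome \<tau>"
      using kronecker_nome_shift[OF \<tau>, of "w - \<tau>" "nome \<tau>"] nome_weights[OF \<tau>] that by simp
    thus ?thesis
      by (simp add: sn_q_def nome_diff)
  qed
  show ?thesis
    unfolding quasi_elliptic_def using hol lim sn_q_minus_one per by auto
qed

text \<open>
  In the strip \<open>- 1 < lat_re \<tau> w < 0\<close> this is the cosine series of the theorem; passing to \<open>- 1 / \<tau>\<close>
  and \<open>w / \<tau>\<close> exchanges the two lattice coordinates.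
\<close>

definition sn_p :: "complex \<Rightarrow> complex \<Rightarrow> complex" where
  "sn_p \<tau> w = \<i> / (2 * \<tau>) * kronecker (nome (- 1 / \<tau>) ^ 2) (- 1) (nome (w / \<tau>) ^ 2)"

lemma Im_uminus_inverse:
  assumes "Im \<tau> > 0"
  shows "Im (- 1 / \<tau>) > 0"
  using assms by (simp add: Im_divide sum_power2_gt_zero_iff)

text \<open>The sign in the second coordinate is what places the convergence of the cosine series at
  negative \<open>lat_re\<close>.\<close>

lemma lat_divide:
  assumes \<tau>: "Im \<tau> > 0"
  shows "lat_re (- 1 / \<tau>) (w / \<tau>) = lat_im \<tau> w"
    and "lat_im (- 1 / \<tau>) (w / \<tau>) = - lat_re \<tau> w"
proof -
  define a b where "a = lat_re \<tau> w" and "b = lat_im \<tau> w"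
  have "\<tau> \<noteq> 0" using \<tau> by auto
  moreover have "w = of_real a + of_real b * \<tau>"
    unfolding a_def b_def by (rule lat_decomp[OF \<tau>])
  ultimately have "w / \<tau> = of_real b + of_real (- a) * (- 1 / \<tau>)"
    by (simp add: field_simps)
  thus "lat_re (- 1 / \<tau>) (w / \<tau>) = lat_im \<tau> w" "lat_im (- 1 / \<tau>) (w / \<tau>) = - lat_re \<tau> w"
    unfolding a_def[symmetric] b_def[symmetric] by (simp_all only: lat_coords[OF Im_uminus_inverse[OF \<tau>]])
qed

lemma sn_p_minus_tau:
  assumes "Im \<tau> > 0"
  shows "sn_p \<tau> (w - \<tau>) = sn_p \<tau> w"
proof -
  have "\<tau> \<noteq> 0" using assms by auto
  hence "(w - \<tau>) / \<tau> = w / \<tau> - 1"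
    by (simp add: field_simps)
  thus ?thesis by (simp add: sn_p_def nome_diff nome_1)
qed

text \<open>The roles of the translations are exchanged: w - 1 is a shift by \<sigma> = -1 / \<tau>
  in w / \<tau> and meets the multiplier 1 / W = -1, while w - \<tau> leaves the squared nome
  unchanged. The factor 1 / \<tau> in \<open>sn_p\<close> makes up for the rescaling of the
  residue.\<close>

lemma quasi_elliptic_sn_p:
  assumes \<tau>: "Im \<tau> > 0"
  shows "quasi_elliptic \<tau> (- 1 / (4 * of_real pi)) (sn_p \<tau>)"
proof -
  define \<sigma> where "\<sigma> = - 1 / \<tau>"
  have \<sigma>: "Im \<sigma> > 0"
    unfolding \<sigma>_def by (rule Im_uminus_inverse[OF \<tau>])
  have \<tau>0: "\<tau> \<noteq> 0" using \<tau> by auto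
  define k where "k = (\<lambda>v. kronecker (nome \<sigma> ^ 2) (- 1) (nome v ^ 2))"
  have sn: "sn_p \<tau> w = \<i> / (2 * \<tau>) * k (w / \<tau>)" for w
    by (simp add: sn_p_def k_def \<sigma>_def)
  have "k \<circ> (\<lambda>w. w / \<tau>) holomorphic_on cell \<tau> - {0}"
  proof (rule holomorphic_on_compose_gen)
    show "k holomorphic_on cell \<sigma> - {0}"
      unfolding k_def by (intro kronecker_nome_holomorphic \<sigma>) auto
    show "(\<lambda>w. w / \<tau>) ` (cell \<tau> - {0}) \<subseteq> cell \<sigma> - {0}"
      using \<tau>0 lat_divide[OF \<tau>] by (auto simp: cell_def \<sigma>_def)
  qed (use \<tau>0 in \<open>auto intro!: holomorphic_intros\<close>)
  hence hol: "sn_p \<tau> holomorphic_on cell \<tau> - {0}"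
    unfolding sn o_def by (intro holomorphic_intros) (use \<tau>0 in auto)
  have "filterlim (\<lambda>w. w / \<tau>) (at 0) (at 0)"
    using \<tau>0 by (auto simp: filterlim_at eventually_at_filter intro!: tendsto_eq_intros)
  moreover have "((\<lambda>v. v * k v) \<longlongrightarrow> \<i> / (2 * of_real pi)) (at 0)"
    unfolding k_def by (intro kronecker_nome_residue \<sigma>) auto
  ultimately have "((\<lambda>w. w / \<tau> * k (w / \<tau>)) \<longlongrightarrow> \<i> / (2 * of_real pi)) (at 0)"
    by (rule filterlim_compose[rotated])
  hence "((\<lambda>w. \<i> / 2 * (w / \<tau> * k (w / \<tau>))) \<longlongrightarrow> \<i> / 2 * (\<i> / (2 * of_real pi))) (at 0)"
    by (intro tendsto_mult tendsto_const)
  hence lim: "((\<lambda>w. w * sn_p \<tau> w) \<longlongrightarrow> - 1 / (4 * of_real pi)) (at 0)"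
    by (simp add: sn mult_ac)
  have anti: "sn_p \<tau> (w - 1) = - sn_p \<tau> w" if "0 < lat_re \<tau> w" "lat_re \<tau> w < 1" for w
  proof -
    have "(w - 1) / \<tau> = w / \<tau> + \<sigma>"
      by (simp add: \<sigma>_def diff_divide_distrib)
    moreover have "- 1 < lat_im \<sigma> (w / \<tau>)" "lat_im \<sigma> (w / \<tau>) < 0"
      using lat_divide[OF \<tau>, of w] that by (simp_all add: \<sigma>_def)
    ultimately have "k ((w - 1) / \<tau>) = - k (w / \<tau>)"
      using kronecker_nome_shift[OF \<sigma>, of "w / \<tau>" "- 1"] nome_weights[OF \<sigma>] by (simp add: k_def)
    thus ?thesis by (simp add: sn)
  qed
  show ?thesis
    unfolding quasi_elliptic_def using hol lim sn_p_minus_tau[OF \<tau>] anti by auto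
qed

section \<open>From the doubled cell to the full strips\<close>

lemma lat_add_int:
  assumes "Im \<tau> > 0"
  shows "lat_re \<tau> (w - of_int n) = lat_re \<tau> w - of_int n" "lat_im \<tau> (w - of_int n) = lat_im \<tau> w"
    and "lat_re \<tau> (w - of_int n * \<tau>) = lat_re \<tau> w" "lat_im \<tau> (w - of_int n * \<tau>) = lat_im \<tau> w - of_int n"
  using assms by (simp_all add: lat_re_def lat_im_def divide_simps) (simp_all add: algebra_simps)

lemma invariant_shift_int:
  fixes c w :: complex
  assumes "\<And>u. P (u - c) \<longleftrightarrow> P u"
  shows "P (w - of_int n * c) \<longleftrightarrow> P w"
proof (induction n rule: int_induct[where k = 0])
  case (step1 i)
  thus ?case using assms[of "w - of_int i * c"] by (simp add: algebra_simps)
next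
  case (step2 i)
  thus ?case using assms[of "w - of_int (i - 1) * c"] by (simp add: algebra_simps)
qed simp

text \<open>Rounding \<open>lat_re\<close> moves w into the cell along its strip; the point reached
  is not 0 because \<open>lat_im\<close> is positive. Both sides change sign under each unit step,
  so equality is carried back.\<close>

lemma sn_theta_eq_sn_q:
  assumes \<tau>: "Im \<tau> > 0" and w: "0 < lat_im \<tau> w" "lat_im \<tau> w < 1"
  shows "sn_theta \<tau> w = sn_q \<tau> w"
proof -
  define n where "n = round (lat_re \<tau> w)"
  have "\<bar>lat_re \<tau> w - of_int n\<bar> < 1"
    using of_int_round_abs_le[of "lat_re \<tau> w"] by (simp add: n_def abs_minus_commute)
  hence "w - of_int n \<in> cell \<tau> - {0}"
    using lat_add_int(1,2)[OF \<tau>, of w n] w by (auto simp: cell_def lat_im_def)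
  hence "sn_theta \<tau> (w - of_int n) = sn_q \<tau> (w - of_int n)"
    by (rule quasi_elliptic_unique[OF \<tau> quasi_elliptic_sn_theta[OF \<tau>] quasi_elliptic_sn_q[OF \<tau>]])
  thus ?thesis
    using invariant_shift_int[of "\<lambda>w. sn_theta \<tau> w = sn_q \<tau> w" 1 w n]
    by (simp add: sn_theta_shift[OF \<tau>] sn_q_minus_one)
qed

lemma sn_theta_eq_sn_p:
  assumes \<tau>: "Im \<tau> > 0" and w: "- 1 < lat_re \<tau> w" "lat_re \<tau> w < 0"
  shows "sn_theta \<tau> w = sn_p \<tau> w"
proof -
  define n where "n = round (lat_im \<tau> w)"
  have "\<bar>lat_im \<tau> w - of_int n\<bar> < 1"
    using of_int_round_abs_le[of "lat_im \<tau> w"] by (simp add: n_def abs_minus_commute)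
  hence "w - of_int n * \<tau> \<in> cell \<tau> - {0}"
    using lat_add_int(3,4)[OF \<tau>, of w n] w by (auto simp: cell_def lat_re_def)
  hence "sn_theta \<tau> (w - of_int n * \<tau>) = sn_p \<tau> (w - of_int n * \<tau>)"
    by (rule quasi_elliptic_unique[OF \<tau> quasi_elliptic_sn_theta[OF \<tau>] quasi_elliptic_sn_p[OF \<tau>]])
  thus ?thesis
    using invariant_shift_int[of "\<lambda>w. sn_theta \<tau> w = sn_p \<tau> w" \<tau> w n]
    by (simp add: sn_theta_shift[OF \<tau>] sn_p_minus_tau[OF \<tau>])
qed

section \<open>Term-by-term identification with the sine and cosine series\<close>

lemma sn_q_sums:
  assumes \<tau>: "Im \<tau> > 0" and w: "0 < lat_im \<tau> w" "lat_im \<tau> w < 1"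
  shows "(\<lambda>n. qpow \<tau> (real n + 1/2) * sin ((2 * of_nat n + 1) * of_real pi * (w + 1 - \<tau> / 2))
    / (1 - qpow \<tau> (2 * real n + 1))) sums sn_q \<tau> w"
proof -
  define q P X where "q = nome \<tau>" and "P = nome \<tau> ^ 2" and "X = nome w ^ 2"
  have P: "norm P < 1" "P \<noteq> 0"
    using norm_nome_less_1[OF \<tau>] by (simp_all add: P_def norm_power power_less_one_iff)
  have q0: "q \<noteq> 0" and X0: "X \<noteq> 0" by (simp_all add: q_def X_def)
  have W: "P ^ n * q \<noteq> 1" for n
    unfolding P_def q_def by (rule nome_weights(1)[OF \<tau>])
  have X: "norm P < norm X" "norm X < 1"
    using norm_nome_sq_bounds(2,4)[OF \<tau>, of w] w by (simp_all add: P_def X_def)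
  \<comment> \<open>Because W = q and P = q ^ 2, the indices n and -n - 1 share the denominator 1 -
    q ^ (2 * n + 1), so each pair combines into one sine.\<close>
  have Pq: "P / q = q" by (simp add: P_def q_def power2_eq_square)
  note k = kronecker_sums[OF P W q0 X, unfolded Pq]
  have "(\<lambda>n. \<i> / 2 * nome w * (X ^ n / (1 - P ^ n * q) - P / (q * X) * ((P / X) ^ n / (1 - P ^ n * q)))) sums
      (\<i> / 2 * nome w * (lambert P q X - P / (q * X) * lambert P q (P / X)))"
    by (intro sums_mult sums_diff k)
  also have "\<i> / 2 * nome w * (lambert P q X - P / (q * X) * lambert P q (P / X)) = sn_q \<tau> w"
    using k(3) by (simp add: sn_q_def P_def q_def X_def)
  also have "(\<lambda>n. \<i> / 2 * nome w * (X ^ n / (1 - P ^ n * q) - P / (q * X) * ((P / X) ^ n / (1 - P ^ n * q)))) =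
      (\<lambda>n. qpow \<tau> (real n + 1/2) * sin ((2 * of_nat n + 1) * of_real pi * (w + 1 - \<tau> / 2))
        / (1 - qpow \<tau> (2 * real n + 1)))"
  proof
    fix n
    define E h where "E = nome w ^ (2 * n + 1)" and "h = qpow \<tau> (real n + 1/2)"
    have nz: "E \<noteq> 0" "h \<noteq> 0" by (simp_all add: E_def h_def qpow_def)
    have hh: "h * h = q ^ (2 * n + 1)"
    proof -
      have "real n + 1/2 + (real n + 1/2) = real (2 * n + 1)" by simp
      thus ?thesis
        unfolding h_def q_def qpow_add[symmetric] by (simp only: qpow_of_nat)
    qed
    have d: "1 - P ^ n * q = 1 - h * h"
      by (simp add: hh P_def q_def flip: power_mult)
    have d0: "1 - h * h \<noteq> 0"
      using W[of n] by (simp flip: d)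
    have q2: "qpow \<tau> (2 * real n + 1) = h * h"
      using qpow_of_nat[of \<tau> "2 * n + 1"] by (simp add: hh q_def add.commute)
    have E1: "nome w * X ^ n = E"
      by (simp add: E_def X_def flip: power_mult)
    have E2: "nome w * (P / (q * X) * (P / X) ^ n) = h * h / E"
    proof -
      have "nome w * (P / (q * X) * (P / X) ^ n) = nome w * (q / X * ((q ^ 2) ^ n / X ^ n))"
        using q0 by (simp add: P_def q_def power_divide power2_eq_square)
      also have "\<dots> = h * h / E"
        by (simp add: hh E_def X_def power2_eq_square power_add power_mult)
      finally show ?thesis .
    qed
    \<comment> \<open>The sign comes from the shift by 1 raised to the odd power 2 * n + 1, and the
      division by h from the shift by -\<tau> / 2.\<close>
    have e: "exp (\<i> * ((2 * of_nat n + 1) * of_real pi * (w + 1 - \<tau> / 2))) = - E / h"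
    proof -
      have "exp (\<i> * ((2 * of_nat n + 1) * of_real pi * (w + 1 - \<tau> / 2))) =
          exp (of_nat (2 * n + 1) * (\<i> * of_real pi * (w + 1)) - \<i> * of_real pi * \<tau> * of_real (real n + 1/2))"
        by (rule arg_cong[where f = exp]) (simp add: field_simps)
      also have "\<dots> = nome (w + 1) ^ (2 * n + 1) / h"
        unfolding exp_diff exp_of_nat_mult nome_def h_def qpow_def ..
      also have "nome (w + 1) ^ (2 * n + 1) = - E"
        by (simp add: nome_add nome_1 E_def)
      finally show ?thesis by simp
    qed
    have s: "sin ((2 * of_nat n + 1) * of_real pi * (w + 1 - \<tau> / 2)) = (- E / h + h / E) / (2 * \<i>)"
      unfolding sin_exp_eq exp_minus e using nz by (simp add: field_simps)
    have "\<i> / 2 * nome w * (X ^ n / (1 - P ^ n * q) - P / (q * X) * ((P / X) ^ n / (1 - P ^ n * q))) =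
        \<i> / 2 * (nome w * X ^ n - nome w * (P / (q * X) * (P / X) ^ n)) / (1 - P ^ n * q)"
    proof -
      have "c * x * (a / d - p * (b / d)) = c * (x * a - x * (p * b)) / d" for a b c d p x :: complex
        by (cases "d = 0") (simp_all add: divide_simps algebra_simps)
      thus ?thesis .
    qed
    also have "\<dots> = \<i> / 2 * (E - h * h / E) / (1 - h * h)"
      unfolding E1 E2 d ..
    also have "\<dots> = h * ((- E / h + h / E) / (2 * \<i>)) / (1 - h * h)"
    proof -
      have "h * (- E / h + h / E) = - (E - h * h / E)"
        using nz by (simp add: field_simps)
      hence "h * ((- E / h + h / E) / (2 * \<i>)) = - (E - h * h / E) / (2 * \<i>)"
        by (simp only: times_divide_eq_right)
      also have "- y / (2 * \<i>) = \<i> / 2 * y" for y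
        by (simp add: field_simps)
      finally show ?thesis by (simp only:)
    qed
    finally show "\<i> / 2 * nome w * (X ^ n / (1 - P ^ n * q) - P / (q * X) * ((P / X) ^ n / (1 - P ^ n * q))) =
        qpow \<tau> (real n + 1/2) * sin ((2 * of_nat n + 1) * of_real pi * (w + 1 - \<tau> / 2))
        / (1 - qpow \<tau> (2 * real n + 1))"
      unfolding s q2 h_def[symmetric] .
  qed
  finally show ?thesis .
qed

lemma qpow_half_quotient:
  assumes \<tau>: "Im \<tau> > 0"
  shows "qpow \<tau> (real n + 1/2) / (1 - qpow \<tau> (2 * real n + 1)) = \<i> / 2 / sin ((of_nat n + 1/2) * of_real pi * \<tau>)"
proof -
  define h where "h = qpow \<tau> (real n + 1/2)"
  have h: "h \<noteq> 0" by (simp add: h_def qpow_def)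
  have h2: "qpow \<tau> (2 * real n + 1) = h * h"
    by (simp add: h_def flip: qpow_add)
  have "nome \<tau> ^ (2 * n + 1) \<noteq> 1"
    by (rule power_nome_ne[OF \<tau>]) auto
  hence "h * h \<noteq> 1"
    using qpow_of_nat[of \<tau> "2 * n + 1"] by (simp flip: h2 add: add.commute)
  have e: "exp (\<i> * ((of_nat n + 1/2) * of_real pi * \<tau>)) = h"
    by (simp add: h_def qpow_def mult_ac)
  have s: "sin ((of_nat n + 1/2) * of_real pi * \<tau>) = (h - 1 / h) / (2 * \<i>)"
    unfolding sin_exp_eq exp_minus e by (simp add: inverse_eq_divide)
  have "h - 1 / h \<noteq> 0" "1 - h * h \<noteq> 0"
    using h \<open>h * h \<noteq> 1\<close> by (auto simp: field_simps)
  thus ?thesis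
    unfolding s h2 h_def[symmetric] using h by (simp add: divide_simps) (simp add: algebra_simps)
qed

lemma sn_p_sums:
  assumes \<tau>: "Im \<tau> > 0" and w: "- 1 < lat_re \<tau> w" "lat_re \<tau> w < 0"
  shows "(\<lambda>n. (-1) ^ Suc n * cos (of_nat (Suc n) * of_real pi * (2 * (w + 1 - \<tau> / 2) - 1) / \<tau>)
    / cos (of_nat (Suc n) * of_real pi / \<tau>)) sums ((sn_p \<tau> w - \<i> / (4 * \<tau>)) / (\<i> / (2 * \<tau>)))"
proof -
  define \<sigma> v where "\<sigma> = - 1 / \<tau>" and "v = w / \<tau>"
  define p P X where "p = nome \<sigma>" and "P = nome \<sigma> ^ 2" and "X = nome v ^ 2"
  have \<sigma>: "Im \<sigma> > 0"
    unfolding \<sigma>_def by (rule Im_uminus_inverse[OF \<tau>])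
  have \<tau>0: "\<tau> \<noteq> 0" using \<tau> by auto
  have P: "norm P < 1" "P \<noteq> 0"
    using norm_nome_less_1[OF \<sigma>] by (simp_all add: P_def norm_power power_less_one_iff)
  have X0: "X \<noteq> 0" by (simp add: X_def)
  have W: "P ^ n * (- 1) \<noteq> 1" for n
    unfolding P_def by (rule nome_weights(3)[OF \<sigma>])
  have X: "norm P < norm X" "norm X < 1"
    using norm_nome_sq_bounds(2,4)[OF \<sigma>, of v] w lat_divide[OF \<tau>, of w]
    by (simp_all add: P_def X_def \<sigma>_def v_def)
  note k = kronecker_sums[OF P W _ X]
  \<comment> \<open>The term n = 0, with value 1 / (1 + 1), is removed from the nonnegative half.
    Then the indices m = n + 1 and -m are paired, which gives cosines.\<close>
  have "(\<lambda>n. X ^ Suc n / (1 - P ^ Suc n * (- 1)) - P / (- 1 * X) * ((P / X) ^ n / (1 - P ^ n * (P / (- 1))))) sums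
      (lambert P (- 1) X - 1 / 2 - P / (- 1 * X) * lambert P (P / (- 1)) (P / X))"
    using k(1) sums_Suc_iff[of "\<lambda>n. X ^ n / (1 - P ^ n * (- 1))" "lambert P (- 1) X - 1 / 2"]
    by (intro sums_mult sums_diff k) auto
  also have "lambert P (- 1) X - 1 / 2 - P / (- 1 * X) * lambert P (P / (- 1)) (P / X) = kronecker P (- 1) X - 1 / 2"
    using k(3) by simp
  also have "\<dots> = (sn_p \<tau> w - \<i> / (4 * \<tau>)) / (\<i> / (2 * \<tau>))"
    using \<tau>0 by (simp add: sn_p_def P_def X_def \<sigma>_def v_def field_simps)
  also have "(\<lambda>n. X ^ Suc n / (1 - P ^ Suc n * (- 1)) - P / (- 1 * X) * ((P / X) ^ n / (1 - P ^ n * (P / (- 1))))) =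
      (\<lambda>n. (-1) ^ Suc n * cos (of_nat (Suc n) * of_real pi * (2 * (w + 1 - \<tau> / 2) - 1) / \<tau>)
        / cos (of_nat (Suc n) * of_real pi / \<tau>))"
  proof
    fix n
    define m where "m = Suc n"
    define Z where "Z = X ^ m"
    define h where "h = p ^ m"
    have nz: "Z \<noteq> 0" "h \<noteq> 0" using X0 by (simp_all add: Z_def h_def p_def)
    have Pm: "P ^ m = h * h"
      by (simp add: P_def h_def p_def power2_eq_square power_mult_distrib)
    have d0: "1 + h * h \<noteq> 0"
      using W[of m] by (simp add: Pm) (metis add.inverse_inverse add_eq_0_iff)
    have e1: "exp (\<i> * (of_nat m * of_real pi / \<tau>)) = 1 / h"
    proof -
      have "exp (\<i> * (of_nat m * of_real pi / \<tau>)) = exp (of_nat m * (\<i> * of_real pi * (1 / \<tau>)))"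
        by (rule arg_cong[where f = exp]) (simp add: field_simps)
      also have "\<dots> = nome (- \<sigma>) ^ m"
        unfolding exp_of_nat_mult by (simp add: nome_def \<sigma>_def)
      finally show ?thesis
        by (simp add: nome_uminus h_def p_def power_one_over)
    qed
    have c1: "cos (of_nat m * of_real pi / \<tau>) = (1 / h + h) / 2"
      unfolding cos_exp_eq exp_minus e1 using nz by simp
    \<comment> \<open>Here (2 * z - 1) / \<tau> = 2 * v - \<sigma> - 1; the final -1 yields (-1) ^
      m, which cancels the alternating sign of the cosine series.\<close>
    have e2: "exp (\<i> * (of_nat m * of_real pi * (2 * (w + 1 - \<tau> / 2) - 1) / \<tau>)) = (- 1) ^ m * (Z / h)"
    proof -
      have "exp (\<i> * (of_nat m * of_real pi * (2 * (w + 1 - \<tau> / 2) - 1) / \<tau>)) =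
          exp (of_nat m * (\<i> * of_real pi * (v + v - \<sigma> - 1)))"
        by (rule arg_cong[where f = exp]) (use \<tau>0 in \<open>simp add: v_def \<sigma>_def field_simps\<close>)
      also have "\<dots> = nome (v + v - \<sigma> - 1) ^ m"
        unfolding exp_of_nat_mult nome_def ..
      also have "\<dots> = (- (X / p)) ^ m"
        unfolding nome_add nome_diff nome_1 X_def p_def power2_eq_square by simp
      also have "\<dots> = (- 1) ^ m * (Z / h)"
        by (subst power_minus) (simp add: Z_def h_def power_divide)
      finally show ?thesis .
    qed
    have s: "(- 1 :: complex) ^ m * (- 1) ^ m = 1"
      by (simp flip: power_mult_distrib)
    have "inverse ((- 1) ^ m * (Z / h)) = (- 1) ^ m * (h / Z)"
      using nz by (simp add: field_simps flip: power_mult_distrib)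
    hence c2: "(- 1) ^ m * cos (of_nat m * of_real pi * (2 * (w + 1 - \<tau> / 2) - 1) / \<tau>) = (Z / h + h / Z) / 2"
      unfolding cos_exp_eq exp_minus e2 by (simp add: s distrib_left flip: mult.assoc)
    have "P / (- 1 * X) * ((P / X) ^ n / (1 - P ^ n * (P / (- 1)))) = - ((P / X) ^ m / (1 + P ^ m))"
      by (simp add: m_def)
    also have "\<dots> = - (h * h / Z / (1 + h * h))"
      by (simp add: power_divide Pm Z_def)
    finally have "X ^ Suc n / (1 - P ^ Suc n * (- 1)) - P / (- 1 * X) * ((P / X) ^ n / (1 - P ^ n * (P / (- 1)))) =
        Z / (1 + h * h) + h * h / Z / (1 + h * h)"
      unfolding m_def[symmetric] Pm Z_def[symmetric] by simp
    also have "\<dots> = ((Z / h + h / Z) / 2) / ((1 / h + h) / 2)"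
    proof -
      have "1 / h + h \<noteq> 0" using d0 nz by (simp add: field_simps)
      thus ?thesis using nz d0 by (simp add: divide_simps) (simp add: algebra_simps)
    qed
    finally show "X ^ Suc n / (1 - P ^ Suc n * (- 1)) - P / (- 1 * X) * ((P / X) ^ n / (1 - P ^ n * (P / (- 1)))) =
        (-1) ^ Suc n * cos (of_nat (Suc n) * of_real pi * (2 * (w + 1 - \<tau> / 2) - 1) / \<tau>)
        / cos (of_nat (Suc n) * of_real pi / \<tau>)"
      unfolding m_def[symmetric] c1 c2 .
  qed
  finally show ?thesis .
qed

theorem mainTheorem5:
  fixes \<tau> z :: complex and \<alpha> \<beta> :: real
  assumes "Im \<tau> > 0"
    and "z = 1/2 + of_real \<alpha> + of_real \<beta> * \<tau>"
  shows "(\<bar>\<beta>\<bar> < 1/2 \<longrightarrow>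
      summable (\<lambda>n. qpow \<tau> (real n + 1/2) * sin ((2 * of_nat n + 1) * of_real pi * z)
                       / (1 - qpow \<tau> (2 * real n + 1)))
    \<and> SN z \<tau> = (\<Sum>n. qpow \<tau> (real n + 1/2) * sin ((2 * of_nat n + 1) * of_real pi * z)
                       / (1 - qpow \<tau> (2 * real n + 1)))
    \<and> summable (\<lambda>n. sin ((2 * of_nat n + 1) * of_real pi * z)
                       / sin ((of_nat n + 1/2) * of_real pi * \<tau>))
    \<and> SN z \<tau> = \<i> / 2 * (\<Sum>n. sin ((2 * of_nat n + 1) * of_real pi * z)
                       / sin ((of_nat n + 1/2) * of_real pi * \<tau>)))
  \<and> (\<bar>\<alpha>\<bar> < 1/2 \<longrightarrow>
      summable (\<lambda>n. (-1) ^ Suc n * cos (of_nat (Suc n) * of_real pi * (2 * z - 1) / \<tau>)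
                       / cos (of_nat (Suc n) * of_real pi / \<tau>))
    \<and> SN z \<tau> = \<i> / (4 * \<tau>) + \<i> / (2 * \<tau>) *
        (\<Sum>n. (-1) ^ Suc n * cos (of_nat (Suc n) * of_real pi * (2 * z - 1) / \<tau>)
                       / cos (of_nat (Suc n) * of_real pi / \<tau>)))"
proof -
  note \<tau> = assms(1)
  have \<tau>0: "\<tau> \<noteq> 0" using \<tau> by auto
  \<comment> \<open>These coordinates turn the two symmetric conditions on \<beta> and \<alpha> into
    the strips 0 < \<open>lat_im\<close> < 1 and -1 < \<open>lat_re\<close> < 0.\<close>
  define w where "w = of_real (\<alpha> - 1/2) + of_real (\<beta> + 1/2) * \<tau>"
  have w: "lat_re \<tau> w = \<alpha> - 1/2" "lat_im \<tau> w = \<beta> + 1/2"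
    unfolding w_def by (rule lat_coords[OF \<tau>])+
  have z: "z = w + 1 - \<tau> / 2" "w = z - 1 + \<tau> / 2"
    by (simp_all add: assms(2) w_def field_simps)
  have SN: "SN z \<tau> = sn_theta \<tau> w"
    using SN_eq_sn_theta[OF \<tau>, of z] by (simp flip: z(2))
  show ?thesis
  proof (intro conjI[of "_ \<longrightarrow> _"] impI)
    assume "\<bar>\<beta>\<bar> < 1/2"
    hence b: "0 < lat_im \<tau> w" "lat_im \<tau> w < 1" by (simp_all add: w)
    have 1: "(\<lambda>n. qpow \<tau> (real n + 1/2) * sin ((2 * of_nat n + 1) * of_real pi * z)
        / (1 - qpow \<tau> (2 * real n + 1))) sums SN z \<tau>"
      using sn_q_sums[OF \<tau> b, folded z(1)] unfolding SN sn_theta_eq_sn_q[OF \<tau> b] .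
    have "qpow \<tau> (real n + 1/2) * sin ((2 * of_nat n + 1) * of_real pi * z) / (1 - qpow \<tau> (2 * real n + 1)) =
        \<i> / 2 * (sin ((2 * of_nat n + 1) * of_real pi * z) / sin ((of_nat n + 1/2) * of_real pi * \<tau>))" for n
      using arg_cong[OF qpow_half_quotient[OF \<tau>, of n], of "\<lambda>x. x * sin ((2 * of_nat n + 1) * of_real pi * z)"]
      by (simp only: times_divide_eq_left times_divide_eq_right)
    hence "(\<lambda>n. \<i> / 2 * (sin ((2 * of_nat n + 1) * of_real pi * z) / sin ((of_nat n + 1/2) * of_real pi * \<tau>)))
        sums (\<i> / 2 * (SN z \<tau> / (\<i> / 2)))"
      using 1 by simp
    hence 2: "(\<lambda>n. sin ((2 * of_nat n + 1) * of_real pi * z) / sin ((of_nat n + 1/2) * of_real pi * \<tau>))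
        sums (SN z \<tau> / (\<i> / 2))"
      by (subst (asm) sums_mult_iff) auto
    show "summable (\<lambda>n. qpow \<tau> (real n + 1/2) * sin ((2 * of_nat n + 1) * of_real pi * z)
                       / (1 - qpow \<tau> (2 * real n + 1)))
    \<and> SN z \<tau> = (\<Sum>n. qpow \<tau> (real n + 1/2) * sin ((2 * of_nat n + 1) * of_real pi * z)
                       / (1 - qpow \<tau> (2 * real n + 1)))
    \<and> summable (\<lambda>n. sin ((2 * of_nat n + 1) * of_real pi * z)
                       / sin ((of_nat n + 1/2) * of_real pi * \<tau>))
    \<and> SN z \<tau> = \<i> / 2 * (\<Sum>n. sin ((2 * of_nat n + 1) * of_real pi * z)
                       / sin ((of_nat n + 1/2) * of_real pi * \<tau>))"
      unfolding sums_unique[OF 1, symmetric] sums_unique[OF 2, symmetric]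
      using sums_summable[OF 1] sums_summable[OF 2] by simp
  next
    assume "\<bar>\<alpha>\<bar> < 1/2"
    hence a: "- 1 < lat_re \<tau> w" "lat_re \<tau> w < 0" by (simp_all add: w)
    have 1: "(\<lambda>n. (-1) ^ Suc n * cos (of_nat (Suc n) * of_real pi * (2 * z - 1) / \<tau>)
        / cos (of_nat (Suc n) * of_real pi / \<tau>)) sums ((SN z \<tau> - \<i> / (4 * \<tau>)) / (\<i> / (2 * \<tau>)))"
      using sn_p_sums[OF \<tau> a, folded z(1)] unfolding SN sn_theta_eq_sn_p[OF \<tau> a] .
    show "summable (\<lambda>n. (-1) ^ Suc n * cos (of_nat (Suc n) * of_real pi * (2 * z - 1) / \<tau>)
                       / cos (of_nat (Suc n) * of_real pi / \<tau>))
    \<and> SN z \<tau> = \<i> / (4 * \<tau>) + \<i> / (2 * \<tau>) *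
        (\<Sum>n. (-1) ^ Suc n * cos (of_nat (Suc n) * of_real pi * (2 * z - 1) / \<tau>)
                       / cos (of_nat (Suc n) * of_real pi / \<tau>))"
      unfolding sums_unique[OF 1, symmetric]
      using sums_summable[OF 1] \<tau>0 by simp
  qed
qed

end
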